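(* Let $1\le p<\infty$ and let $A=(a_{nk})_{n,k\ge0}$ be complex scalars with $\sum_k|a_{nk}|<\infty$ for each $n$. For holomorphic $f(z)=\sum_k\hat f(k)z^k$ on the unit disk put $S_n^A(f):=\sum_{k\ge0}a_{nk}\hat f(k)z^k$. If $\|S_n^A(f)-f\|_{H^p}\to0$ for all $f\in H^p$, then $\|S_n^A(g)-g\|_{A^p}\to0$ for all $g\in A^p$.
   Context: $H^p$ is the Hardy space of holomorphic $f$ on the unit disk $\mathbb D$ with $\|f\|_{H^p}=\sup_{r<1}\bigl(\frac1{2\pi}\int_0^{2\pi}|f(re^{i\theta})|^pd\theta\bigr)^{1/p}<\infty$. $A^p$ is the Bergman space of holomorphic $f$ on $\mathbb D$ with $\|f\|_{A^p}=\bigl(\frac1\pi\int_{\mathbb D}|f|^pdA\bigr)^{1/p}<\infty$, $dA$ area measure. *)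

theory Defs
  imports "HOL-Complex_Analysis.Complex_Analysis"
begin

definition taylor_coeff :: "(complex \<Rightarrow> complex) \<Rightarrow> nat \<Rightarrow> complex" where
  "taylor_coeff f k = (deriv ^^ k) f 0 / of_nat (fact k)"

definition enn_root :: "real \<Rightarrow> ennreal \<Rightarrow> ennreal" where
  "enn_root p M = (if M = \<infinity> then \<infinity> else ennreal ((enn2real M) powr (1 / p)))"

definition hardy_norm :: "real \<Rightarrow> (complex \<Rightarrow> complex) \<Rightarrow> ennreal" where
  "hardy_norm p f = enn_root p
     (SUP r\<in>{0<..<1::real}. ennreal (1 / (2 * pi)) *
        (\<integral>\<^sup>+ \<theta>. ennreal (norm (f (complex_of_real r * cis \<theta>)) powr p) * indicator {0..2*pi} \<theta> \<partial>lborel))"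

definition bergman_norm :: "real \<Rightarrow> (complex \<Rightarrow> complex) \<Rightarrow> ennreal" where
  "bergman_norm p f = enn_root p
     (ennreal (1 / pi) *
        (\<integral>\<^sup>+ z. ennreal (norm (f z) powr p) * indicator (ball 0 1) z \<partial>lborel))"

definition hardy_space :: "real \<Rightarrow> (complex \<Rightarrow> complex) set" where
  "hardy_space p = {f. f holomorphic_on ball 0 1 \<and> hardy_norm p f < \<infinity>}"

definition bergman_space :: "real \<Rightarrow> (complex \<Rightarrow> complex) set" where
  "bergman_space p = {f. f holomorphic_on ball 0 1 \<and> bergman_norm p f < \<infinity>}"

definition summation_op :: "(nat \<Rightarrow> nat \<Rightarrow> complex) \<Rightarrow> nat \<Rightarrow> (complex \<Rightarrow> complex) \<Rightarrow> complex \<Rightarrow> complex" where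
  "summation_op A n f z = (\<Sum>k. A n k * taylor_coeff f k * z ^ k)"

end

theory Submission
  imports Defs
begin

text \<open>
  For \<open>z\<close> in the disk let \<open>g\<^sub>z w = g (z * w)\<close>, which lies in \<open>H\<^sup>p\<close> because it is holomorphic beyond the
  unit circle. By rotation invariance of area, \<open>\<parallel>g\<parallel>\<^sup>p\<close> in \<open>A\<^sup>p\<close> is the average over \<open>z\<close> of the mean of \<open>\<bar>g\<^sub>z\<bar>\<^sup>p\<close>
  over the unit circle, and this mean is \<open>\<parallel>g\<^sub>z\<parallel>\<^sup>p\<close> in \<open>H\<^sup>p\<close> since circle means increase with the radius
  (Poisson formula and Jensen's inequality). The summation operators commute with \<open>g \<mapsto> g\<^sub>z\<close>. Hence
  \<open>\<parallel>S\<^sub>n g - g\<parallel>\<^sup>p\<close> in \<open>A\<^sup>p\<close> is the average over \<open>z\<close> of \<open>\<parallel>S\<^sub>n g\<^sub>z - g\<^sub>z\<parallel>\<^sup>p\<close> in \<open>H\<^sup>p\<close>. The integrand tends to \<open>0\<close>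
  pointwise by assumption and, by the uniform boundedness principle on \<open>H\<^sup>p\<close>, is dominated by a constant
  multiple of \<open>\<parallel>g\<^sub>z\<parallel>\<^sup>p\<close>, so dominated convergence applies.
\<close>

subsection \<open>Rotation invariance of area\<close>

text \<open>Orthogonal maps act on \<open>real^2\<close>; this identification carries their
  invariance over to the complex plane. Boxes correspond under the coordinate map, and a measure
  with the right value on boxes is \<open>lborel\<close>.\<close>

lemma lborel_complex_eq_distr:
  "(lborel :: complex measure) = distr (lborel :: (real^2) measure) borel (\<lambda>x. Complex (x $ 1) (x $ 2))"
proof (rule lborel_eqI)
  fix l u :: complex
  assume le: "\<And>b. b \<in> Basis \<Longrightarrow> l \<bullet> b \<le> u \<bullet> b"
  have [measurable]: "(\<lambda>x::real^2. Complex (x $ 1) (x $ 2)) \<in> borel_measurable borel"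
    by (intro borel_measurable_continuous_onI) (auto simp: Complex_eq intro!: continuous_intros)
  have vec: "(\<Prod>b\<in>Basis. (v::real^2) \<bullet> b) = v $ 1 * v $ 2" for v
    by (simp add: Basis_vec_def inner_axis UNION_singleton_eq_range prod.reindex inj_def axis_eq_axis UNIV_2)
  have "(\<lambda>x::real^2. Complex (x $ 1) (x $ 2)) -` box l u =
      box (\<chi> i. if i = 1 then Re l else Im l) (\<chi> i. if i = 1 then Re u else Im u)"
    by (auto simp: box_Complex_eq mem_box_cart forall_2 complex_eq_iff in_box_complex_iff)
  moreover have "Re l \<le> Re u" "Im l \<le> Im u"
    using le[of 1] le[of \<i>] by (auto simp: Basis_complex_def)
  moreover from this have "\<forall>b\<in>Basis. (\<chi> i. if i = 1 then Re l else Im l :: real^2) \<bullet> b \<le> (\<chi> i. if i = 1 then Re u else Im u) \<bullet> b"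
    by (auto simp: Basis_vec_def inner_axis)
  ultimately show "emeasure (distr lborel borel (\<lambda>x::real^2. Complex (x $ 1) (x $ 2))) (box l u) =
      ennreal (\<Prod>b\<in>Basis. (u - l) \<bullet> b)"
    by (simp add: emeasure_distr emeasure_lborel_box_eq vec) (simp add: Basis_complex_def)
qed simp

text \<open>Boundedness makes the measure finite, so the invariance of the real-valued
  \<open>measure\<close> lifts to \<open>emeasure\<close>. Both sets are Borel, where the Lebesgue
  measure agrees with \<open>lborel\<close>.\<close>

lemma emeasure_lborel_orthogonal_image:
  fixes f :: "real^'n::{finite,wellorder} \<Rightarrow> real^'n::_"
  assumes f: "orthogonal_transformation f" and S: "S \<in> sets borel" "bounded S"
  shows "emeasure lborel (f ` S) = emeasure lborel S"
proof -
  have lm: "S \<in> lmeasurable" using S by (intro bounded_set_imp_lmeasurable) auto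
  have "f ` S = inv f -` S"
    \<comment> \<open>The image is written as a preimage under the continuous inverse, which shows
      that it is Borel.\<close>
    using orthogonal_transformation_bij[OF f] by (simp add: bij_image_Collect_eq bij_vimage_eq_inv_image bij_imp_bij_inv inv_inv_eq)
  moreover have "inv f \<in> borel_measurable borel"
    using orthogonal_transformation_linear[OF orthogonal_transformation_inv[OF f]]
    by (intro borel_measurable_continuous_onI linear_continuous_on) (simp add: linear_linear)
  ultimately have fS: "f ` S \<in> sets borel" using measurable_sets[of "inv f" borel borel S] S by simp
  have "emeasure lborel (f ` S) = emeasure lebesgue (f ` S)" using fS by simp
  also have "\<dots> = ennreal (measure lebesgue (f ` S))"
    using measurable_orthogonal_image[OF f lm] by (simp add: emeasure_eq_measure2)
  also have "\<dots> = ennreal (measure lebesgue S)" using measure_orthogonal_image[OF f lm] by simp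
  also have "\<dots> = emeasure lebesgue S" using lm by (simp add: emeasure_eq_measure2)
  finally show ?thesis using S by simp
qed

lemma lborel_complex_rotate:
  fixes c :: complex
  assumes c: "norm c = 1"
  shows "distr lborel borel ((*) c) = lborel"
proof (rule lborel_eqI[symmetric])
  fix l u :: complex
  assume le: "\<And>b. b \<in> Basis \<Longrightarrow> l \<bullet> b \<le> u \<bullet> b"
  define \<phi> :: "real^2 \<Rightarrow> complex" where "\<phi> = (\<lambda>x. Complex (x $ 1) (x $ 2))"
  define \<psi> :: "complex \<Rightarrow> real^2" where "\<psi> = (\<lambda>z. \<chi> i. if i = 1 then Re z else Im z)"
  have inv: "\<phi> (\<psi> z) = z" "\<psi> (\<phi> x) = x" for z x
    by (auto simp: \<phi>_def \<psi>_def vec_eq_iff forall_2)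
  have phi[measurable]: "\<phi> \<in> borel_measurable borel" unfolding \<phi>_def
    by (intro borel_measurable_continuous_onI) (auto simp: Complex_eq intro!: continuous_intros)
  \<comment> \<open>\<open>T\<close> is the inverse rotation in real coordinates: the preimage of a
    box under multiplication by \<open>c\<close> is its image under multiplication by
    \<open>cnj c\<close>.\<close>
  define T where "T = (\<lambda>x. \<psi> (cnj c * \<phi> x))"
  have nphi: "norm (\<psi> z) = norm z" for z
    by (simp add: \<psi>_def norm_vec_def L2_set_def UNIV_2 cmod_def)
  have "linear T"
    by (intro linearI) (auto simp: T_def \<phi>_def \<psi>_def vec_eq_iff forall_2 algebra_simps)
  moreover have "norm (T x) = norm x" for x
    using nphi[of "\<phi> x"] c by (simp add: T_def nphi norm_mult inv)
  ultimately have T: "orthogonal_transformation T" by (simp add: orthogonal_transformation)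
  have cc: "c * cnj c = 1" "cnj c * c = 1" using c by (simp_all add: complex_norm_square[symmetric] mult.commute)
  have meas: "(*) c \<in> borel_measurable borel" by simp
  have "emeasure (distr lborel borel ((*) c)) (box l u) = emeasure lborel ((*) c -` box l u)"
    by (simp add: emeasure_distr)
  also have "\<dots> = emeasure lborel (\<phi> -` ((*) c -` box l u))"
    using measurable_sets[OF meas, of "box l u"]
    by (subst lborel_complex_eq_distr) (simp add: emeasure_distr flip: \<phi>_def)
  also have "\<phi> -` ((*) c -` box l u) = T ` (\<phi> -` box l u)"
  proof (intro equalityI subsetI)
    fix x assume "x \<in> \<phi> -` ((*) c -` box l u)"
    then show "x \<in> T ` (\<phi> -` box l u)"
      by (intro image_eqI[of _ _ "\<psi> (c * \<phi> x)"]) (auto simp: T_def inv cc simp flip: mult.assoc)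
  next
    fix x assume "x \<in> T ` (\<phi> -` box l u)"
    then show "x \<in> \<phi> -` ((*) c -` box l u)"
      by (auto simp: T_def inv cc simp flip: mult.assoc)
  qed
  also have "emeasure lborel \<dots> = emeasure lborel (\<phi> -` box l u)"
  proof (intro emeasure_lborel_orthogonal_image T)
    show "\<phi> -` box l u \<in> sets borel" using measurable_sets[OF phi, of "box l u"] by simp
    have "\<phi> -` box l u = \<psi> ` box l u" by (force simp: inv image_iff)
    moreover have "bounded (\<psi> ` box l u)"
      using bounded_box[of l u] unfolding bounded_iff by (auto simp: nphi)
    ultimately show "bounded (\<phi> -` box l u)" by simp
  qed
  also have "\<dots> = emeasure lborel (box l u)"
    by (subst lborel_complex_eq_distr) (simp add: emeasure_distr flip: \<phi>_def)
  finally show "emeasure (distr lborel borel ((*) c)) (box l u) = ennreal (\<Prod>b\<in>Basis. (u - l) \<bullet> b)"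
    using le by (simp add: emeasure_lborel_box_eq)
qed simp

subsection \<open>Means over the unit circle\<close>

text \<open>The convex function \<open>t powr p\<close> lies above its tangent at \<open>a\<close>.
  For positive \<open>t\<close> this is Young's inequality with weights 1/p and 1 - 1/p for the
  numbers \<open>t powr p\<close> and \<open>a powr p\<close>, multiplied by
  \<open>p\<close>.\<close>

lemma powr_tangent:
  fixes p a t :: real
  assumes "1 \<le> p" "0 < a" "0 \<le> t"
  shows "a powr p + p * a powr (p - 1) * (t - a) \<le> t powr p"
proof (cases "t = 0")
  case True
  have "a powr p \<le> p * a powr p" using assms by simp
  then show ?thesis using True assms powr_mult_base[of a "p - 1"] by (simp add: algebra_simps)
next
  case False
  have "(t powr p) powr (1/p) * (a powr p) powr (1 - 1/p) \<le> 1/p * t powr p + (1 - 1/p) * a powr p"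
    using assms False by (intro Youngs_inequality_0) (auto simp: field_simps)
  moreover have "p * (1 - 1/p) = p - 1" using assms by (simp add: field_simps)
  ultimately have *: "t * a powr (p - 1) \<le> 1/p * t powr p + (1 - 1/p) * a powr p"
    using assms by (simp add: powr_powr)
  have "p * (t * a powr (p - 1)) \<le> p * (1/p * t powr p + (1 - 1/p) * a powr p)"
    using * assms by (intro mult_left_mono) auto
  also have "\<dots> = t powr p + (p - 1) * a powr p" using assms by (simp add: field_simps)
  finally show ?thesis
    using powr_mult_base[of a "p - 1"] assms by (simp add: algebra_simps)
qed

text \<open>Add the two tangent inequalities taken at the convex combination itself; the linear
  terms cancel.\<close>

lemma powr_convex_combination:
  fixes p \<alpha> \<beta> x y :: real
  assumes p: "1 \<le> p" and "0 \<le> \<alpha>" "0 \<le> \<beta>" "\<alpha> + \<beta> = 1" "0 \<le> x" "0 \<le> y"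
  shows "(\<alpha> * x + \<beta> * y) powr p \<le> \<alpha> * x powr p + \<beta> * y powr p"
proof (cases "\<alpha> * x + \<beta> * y = 0")
  case True
  then show ?thesis using assms by simp
next
  case False
  define c where "c = \<alpha> * x + \<beta> * y"
  have c: "0 < c" using False assms by (simp add: c_def less_le)
  have "\<alpha> * (c powr p + p * c powr (p - 1) * (x - c)) + \<beta> * (c powr p + p * c powr (p - 1) * (y - c))
      \<le> \<alpha> * x powr p + \<beta> * y powr p"
    using assms c by (intro add_mono mult_left_mono powr_tangent)
  also have "\<alpha> * (c powr p + p * c powr (p - 1) * (x - c)) + \<beta> * (c powr p + p * c powr (p - 1) * (y - c))
      = (\<alpha> + \<beta>) * c powr p + p * c powr (p - 1) * (c - (\<alpha> + \<beta>) * c)"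
    by (simp add: c_def algebra_simps)
  finally show ?thesis using assms by (simp add: c_def)
qed

text \<open>The sum is \<open>a + b\<close> times the convex combination of \<open>x / a\<close> and
  \<open>y / b\<close> with weights \<open>a / (a + b)\<close> and \<open>b / (a + b)\<close>.
  Integrated with norm bounds \<open>a\<close> and \<open>b\<close>, it becomes Minkowski's
  inequality without any roots.\<close>

lemma powr_add_le_weighted:
  fixes p a b x y :: real
  assumes "1 \<le> p" "0 < a" "0 < b" "0 \<le> x" "0 \<le> y"
  shows "(x + y) powr p \<le> (a + b) powr p * (a / (a + b) * (x powr p / a powr p) + b / (a + b) * (y powr p / b powr p))"
proof -
  have "x + y = (a + b) * (a / (a + b) * (x / a) + b / (a + b) * (y / b))"
    using assms by (simp add: distrib_left)
  then have "(x + y) powr p = (a + b) powr p * (a / (a + b) * (x / a) + b / (a + b) * (y / b)) powr p"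
    using assms by (metis (no_types, lifting) add_nonneg_nonneg powr_mult)
  also have "\<dots> \<le> (a + b) powr p * (a / (a + b) * (x / a) powr p + b / (a + b) * (y / b) powr p)"
    using assms by (intro mult_left_mono powr_convex_combination) (auto simp flip: add_divide_distrib)
  finally show ?thesis using assms by (simp add: powr_divide)
qed

section \<open>Circle means and Minkowski's inequality\<close>

text \<open>The \<open>p\<close>-th power of the mean: no root is taken.\<close>
definition circle_mean :: "real \<Rightarrow> (complex \<Rightarrow> complex) \<Rightarrow> real" where
  "circle_mean p f = integral {0..2*pi} (\<lambda>t. norm (f (cis t)) powr p) / (2 * pi)"

lemma continuous_on_compose_cis:
  "continuous_on (sphere 0 1) f \<Longrightarrow> continuous_on S (\<lambda>t. f (cis t))"
  by (erule continuous_on_compose2) (auto intro!: continuous_intros)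

lemma continuous_on_norm_powr:
  fixes f :: "'a::topological_space \<Rightarrow> 'b::real_normed_vector"
  assumes "0 < p" "continuous_on S f"
  shows "continuous_on S (\<lambda>x. norm (f x) powr p)"
  using assms by (intro continuous_on_powr' continuous_intros) auto

lemma circle_mean_integrable:
  assumes "0 < p" "continuous_on (sphere 0 1) f"
  shows "(\<lambda>t. norm (f (cis t)) powr p) integrable_on {0..2*pi}"
  by (intro integrable_continuous_interval continuous_on_norm_powr[OF assms(1)] continuous_on_compose_cis[OF assms(2)])

lemma circle_mean_has_integral:
  assumes "0 < p" "continuous_on (sphere 0 1) f"
  shows "((\<lambda>t. norm (f (cis t)) powr p) has_integral 2 * pi * circle_mean p f) {0..2*pi}"
  using integrable_integral[OF circle_mean_integrable[OF assms]] by (simp add: circle_mean_def)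

lemma circle_mean_nonneg: "0 \<le> circle_mean p f"
  \<comment> \<open>A non-integrable integrand gives the default value 0.\<close>
  unfolding circle_mean_def by (cases "(\<lambda>t. norm (f (cis t)) powr p) integrable_on {0..2*pi}")
    (auto intro!: integral_nonneg divide_nonneg_nonneg simp: not_integrable_integral)

lemma circle_mean_le:
  assumes "0 < p" "continuous_on (sphere 0 1) f"
    and le: "\<And>t. t \<in> {0..2*pi} \<Longrightarrow> norm (f (cis t)) powr p \<le> g t"
    and g: "(g has_integral 2 * pi * K) {0..2*pi}"
  shows "circle_mean p f \<le> K"
  using has_integral_le[OF circle_mean_has_integral[OF assms(1,2)] g le] by simp

lemma circle_mean_le_const:
  assumes "0 < p" "continuous_on (sphere 0 1) f"
    and "\<And>z. norm z = 1 \<Longrightarrow> norm (f z) \<le> K"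
  shows "circle_mean p f \<le> K powr p"
  using assms(3) has_integral_const_real[of "K powr p" 0 "2*pi"] assms(1)
  by (intro circle_mean_le[OF assms(1,2), of "\<lambda>_. K powr p"]) (auto intro!: powr_mono2)

lemma circle_mean_cmult:
  assumes "0 < p"
  shows "circle_mean p (\<lambda>z. c * f z) = norm c powr p * circle_mean p f"
  by (simp add: circle_mean_def norm_mult powr_mult)

text \<open>Integrate the weighted pointwise inequality. The normalized means of \<open>f\<close>
  and \<open>g\<close> are at most 1, hence so is their convex combination.\<close>

lemma circle_mean_minkowski:
  assumes p: "1 \<le> p" and f: "continuous_on (sphere 0 1) f" and g: "continuous_on (sphere 0 1) g"
    and a: "0 < a" "circle_mean p f \<le> a powr p" and b: "0 < b" "circle_mean p g \<le> b powr p"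
  shows "circle_mean p (\<lambda>z. f z + g z) \<le> (a + b) powr p"
proof -
  define K where "K = (a + b) powr p * (a / (a + b) * (circle_mean p f / a powr p) + b / (a + b) * (circle_mean p g / b powr p))"
  have p0: "0 < p" using p by simp
  have "circle_mean p (\<lambda>z. f z + g z) \<le> K"
  proof (rule circle_mean_le)
    let ?G = "\<lambda>t. (a + b) powr p * (a / (a + b) * (norm (f (cis t)) powr p / a powr p) + b / (a + b) * (norm (g (cis t)) powr p / b powr p))"
    show "(?G has_integral 2 * pi * K) {0..2*pi}"
    proof -
      have "(?G has_integral (a + b) powr p * (a / (a + b) * (2 * pi * circle_mean p f / a powr p) + b / (a + b) * (2 * pi * circle_mean p g / b powr p))) {0..2*pi}"
        by (intro has_integral_mult_right has_integral_add has_integral_divide circle_mean_has_integral f g p0)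
      then show ?thesis by (simp add: K_def algebra_simps)
    qed
    fix t
    have "norm (f (cis t) + g (cis t)) powr p \<le> (norm (f (cis t)) + norm (g (cis t))) powr p"
      using p by (intro powr_mono2 norm_triangle_ineq) auto
    also have "\<dots> \<le> ?G t" using a b p by (intro powr_add_le_weighted) auto
    finally show "norm (f (cis t) + g (cis t)) powr p \<le> ?G t" .
  qed (use p f g in \<open>auto intro!: continuous_intros\<close>)
  also have "K \<le> (a + b) powr p * (a / (a + b) * 1 + b / (a + b) * 1)"
    unfolding K_def using a b by (intro mult_left_mono add_mono) (auto simp: divide_le_eq_1)
  also have "\<dots> = (a + b) powr p" using a b by (simp add: add_divide_distrib[symmetric])
  finally show ?thesis .
qed

text \<open>A crude form of Hoelder's inequality: integrate x \<le> 1 + x^p with x = |f| / a. The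
  factor 2 is harmless, since it enters only the estimate of Taylor coefficients.\<close>

lemma circle_mean_1_le:
  assumes p: "1 \<le> p" and f: "continuous_on (sphere 0 1) f"
    and a: "0 < a" "circle_mean p f \<le> a powr p"
  shows "circle_mean 1 f \<le> 2 * a"
proof -
  have p0: "0 < p" using p by simp
  have "circle_mean 1 f \<le> a + a * (circle_mean p f / a powr p)"
  proof (rule circle_mean_le)
    have "((\<lambda>t. a + a * (norm (f (cis t)) powr p / a powr p)) has_integral (2 * pi * a) + a * (2 * pi * circle_mean p f / a powr p)) {0..2*pi}"
      using has_integral_const_real[of a 0 "2*pi"]
      by (intro has_integral_mult_right has_integral_add has_integral_divide circle_mean_has_integral f p0) auto
    then show "((\<lambda>t. a + a * (norm (f (cis t)) powr p / a powr p)) has_integral 2 * pi * (a + a * (circle_mean p f / a powr p))) {0..2*pi}"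
      by (simp add: algebra_simps)
    fix t
    define x where "x = norm (f (cis t)) / a"
    have x: "0 \<le> x" using a by (simp add: x_def)
    have "x \<le> 1 + x powr p"
    proof (cases "x \<le> 1")
      case True
      then show ?thesis by (simp add: add_increasing2)
    next
      case False
      then show ?thesis using powr_mono[of 1 p x] p by simp
    qed
    then have "a * x \<le> a * (1 + x powr p)" using a by (intro mult_left_mono) auto
    then show "norm (f (cis t)) powr 1 \<le> a + a * (norm (f (cis t)) powr p / a powr p)"
      using a by (simp add: x_def powr_divide algebra_simps)
  qed (use f in auto)
  also have "\<dots> \<le> a + a * 1" using a by (intro add_left_mono mult_left_mono) (auto simp: divide_le_eq_1)
  finally show ?thesis by simp
qed

lemma nn_integral_circle_mean:
  assumes "0 < p" "continuous_on (sphere 0 1) f"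
  shows "(\<integral>\<^sup>+ \<theta>. ennreal (norm (f (cis \<theta>)) powr p) * indicator {0..2*pi} \<theta> \<partial>lborel) = ennreal (2 * pi * circle_mean p f)"
  by (intro nn_integral_has_integral_lebesgue' circle_mean_has_integral assms) auto

subsection \<open>The Poisson formula\<close>

definition poisson_kernel :: "complex \<Rightarrow> complex \<Rightarrow> real" where
  "poisson_kernel z w = (1 - (norm z)\<^sup>2) / (norm (w - z))\<^sup>2"

lemma poisson_kernel_nonneg: "norm z \<le> 1 \<Longrightarrow> 0 \<le> poisson_kernel z w"
  by (simp add: poisson_kernel_def power_le_one)

lemma continuous_on_poisson_kernel:
  "norm z < 1 \<Longrightarrow> continuous_on (sphere 0 1) (poisson_kernel z)"
  unfolding poisson_kernel_def by (intro continuous_intros) auto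

text \<open>Cauchy's formula applied to \<open>F w * (1 - \<bar>z\<bar>\<^sup>2) / (1 - cnj z * w)\<close>, whose value at \<open>z\<close> is \<open>F z\<close>.\<close>
lemma poisson_formula:
  fixes F :: "complex \<Rightarrow> complex"
  assumes F: "F holomorphic_on ball 0 R" "1 < R" and z: "norm z < 1"
  shows "((\<lambda>t. of_real (poisson_kernel z (cis t)) * F (cis t)) has_integral 2 * pi * F z) {0..2*pi}"
proof -
  define G where "G = (\<lambda>w. F w * (1 - z * cnj z) / (1 - cnj z * w))"
  \<comment> \<open>The pole of \<open>G\<close> is the reflection of \<open>z\<close> in the unit
    circle and lies outside the closed disk.\<close>
  have ne: "1 - cnj z * w \<noteq> 0" if "norm w \<le> 1" for w
  proof
    assume "1 - cnj z * w = 0"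
    then have "norm (cnj z * w) = 1" by (metis eq_iff_diff_eq_0 norm_one)
    moreover have "norm z * norm w \<le> norm z * 1" using that by (intro mult_left_mono) auto
    ultimately show False using z by (simp add: norm_mult)
  qed
  have "G holomorphic_on cball 0 1" unfolding G_def using F ne
    by (intro holomorphic_intros holomorphic_on_subset[OF F(1)]) (auto simp: dist_norm)
  then have "((\<lambda>u. G u / (u - z)) has_contour_integral 2 * pi * \<i> * G z) (part_circlepath 0 1 0 (2 * pi))"
    using Cauchy_integral_circlepath_simple[of G 0 1 z] z by (simp add: circlepath_def)
  then have "((\<lambda>t. G (cis t) / (cis t - z) * \<i> * cis t) has_integral 2 * pi * \<i> * G z) {0..2*pi}"
    by (subst (asm) has_contour_integral_part_circlepath_iff) auto
  from has_integral_divide[OF this, of \<i>]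
  have "((\<lambda>t. G (cis t) / (cis t - z) * cis t) has_integral 2 * pi * G z) {0..2*pi}"
    by (simp add: field_simps)
  moreover have "G z = F z" using ne[of z] z by (simp add: G_def mult.commute)
  moreover have "G (cis t) / (cis t - z) * cis t = of_real (poisson_kernel z (cis t)) * F (cis t)" for t
  proof -
    have wz: "cis t - z \<noteq> 0" using z by auto
    have n2: "complex_of_real ((norm v)\<^sup>2) = v * cnj v" for v :: complex
      by (simp only: complex_norm_square)
    \<comment> \<open>On the unit circle w * cnj w = 1, which turns the Cauchy kernel of
      \<open>G\<close> into the Poisson kernel.\<close>
    have "of_real ((norm (cis t - z))\<^sup>2) * cis t = (1 - cnj z * cis t) * (cis t - z)"
      unfolding n2 using cis_mult[of t "- t"] by (simp add: algebra_simps cis_cnj)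
    then have "cis t / ((1 - cnj z * cis t) * (cis t - z)) = 1 / of_real ((norm (cis t - z))\<^sup>2)"
      using wz ne[of "cis t"] by (subst frac_eq_eq) (auto simp: mult.commute)
    then have "F (cis t) * (1 - z * cnj z) * (cis t / ((1 - cnj z * cis t) * (cis t - z)))
       = F (cis t) * (1 - z * cnj z) * (1 / of_real ((norm (cis t - z))\<^sup>2))" by simp
    moreover have "of_real (poisson_kernel z (cis t)) = (1 - z * cnj z) * (1 / of_real ((norm (cis t - z))\<^sup>2))"
      by (simp only: poisson_kernel_def of_real_divide of_real_diff of_real_1 n2[of z] times_divide_eq_right mult_1_right)
    ultimately show ?thesis by (simp add: G_def mult.commute)
  qed
  ultimately show ?thesis by simp
qed

lemma poisson_kernel_integral:
  assumes "norm z < 1"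
  shows "((\<lambda>t. poisson_kernel z (cis t)) has_integral 2 * pi) {0..2*pi}"
  using has_integral_linear[OF poisson_formula[of "\<lambda>_. 1" 2 z] bounded_linear_Re] assms
  by (simp add: o_def)

text \<open>Jensen's inequality for the probability density given by the kernel: the tangent
  inequality at |F z| is integrated against it, and the Poisson formula bounds |F z| by the weighted
  mean of |F|.\<close>

lemma norm_powr_le_poisson:
  fixes F :: "complex \<Rightarrow> complex"
  assumes p: "1 \<le> p" and F: "F holomorphic_on ball 0 R" "1 < R" and z: "norm z < 1"
  shows "norm (F z) powr p \<le> integral {0..2*pi} (\<lambda>t. poisson_kernel z (cis t) * norm (F (cis t)) powr p) / (2 * pi)"
proof -
  have contF: "continuous_on (sphere 0 1) F"
    using F by (intro holomorphic_on_imp_continuous_on holomorphic_on_subset[OF F(1)]) auto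
  have P0: "0 \<le> poisson_kernel z w" for w using z by (intro poisson_kernel_nonneg) auto
  have contP: "continuous_on {0..2*pi} (\<lambda>t. poisson_kernel z (cis t))"
    using continuous_on_poisson_kernel[OF z] by (rule continuous_on_compose2) (auto intro!: continuous_intros)
  have contFc: "continuous_on {0..2*pi} (\<lambda>t. F (cis t))" by (rule continuous_on_compose_cis[OF contF])
  define a where "a = norm (F z)"
  define I where "I = integral {0..2*pi} (\<lambda>t. poisson_kernel z (cis t) * norm (F (cis t)))"
  define J where "J = integral {0..2*pi} (\<lambda>t. poisson_kernel z (cis t) * norm (F (cis t)) powr p)"
  have I: "((\<lambda>t. poisson_kernel z (cis t) * norm (F (cis t))) has_integral I) {0..2*pi}"
    unfolding I_def by (intro integrable_integral integrable_continuous_interval continuous_intros contP contFc)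
  have J: "((\<lambda>t. poisson_kernel z (cis t) * norm (F (cis t)) powr p) has_integral J) {0..2*pi}"
    unfolding J_def using p by (intro integrable_integral integrable_continuous_interval continuous_on_mult contP continuous_on_norm_powr contFc) auto
  have J0: "0 \<le> J" using P0 by (intro has_integral_nonneg[OF J]) auto
  show ?thesis
  proof (cases "a = 0")
    case True
    then show ?thesis using J0 by (simp add: a_def J_def)
  next
    case False
    then have a: "0 < a" by (simp add: a_def)
    have "norm (2 * pi * F z) \<le> I \<bullet> 1"
      by (rule has_integral_norm_bound_integral_component[OF poisson_formula[OF F z] I])
        (simp add: norm_mult P0)
    then have aI: "2 * pi * a \<le> I" by (simp add: norm_mult a_def)
    \<comment> \<open>The integrated tangent line equals 2 pi a^p + p a^(p-1) (I - 2 pi a), whose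
      second term is nonnegative by \<open>aI\<close>.\<close>
    have "((\<lambda>t. (a powr p - p * a powr (p - 1) * a) * poisson_kernel z (cis t)
        + p * a powr (p - 1) * (poisson_kernel z (cis t) * norm (F (cis t)))) has_integral
      (a powr p - p * a powr (p - 1) * a) * (2 * pi) + p * a powr (p - 1) * I) {0..2*pi}"
      by (intro has_integral_add has_integral_mult_right poisson_kernel_integral z I)
    then have "(a powr p - p * a powr (p - 1) * a) * (2 * pi) + p * a powr (p - 1) * I \<le> J"
    proof (rule has_integral_le[OF _ J])
      fix t
      have "poisson_kernel z (cis t) * (a powr p + p * a powr (p - 1) * (norm (F (cis t)) - a))
          \<le> poisson_kernel z (cis t) * norm (F (cis t)) powr p"
        using p a by (intro mult_left_mono powr_tangent P0) auto
      then show "(a powr p - p * a powr (p - 1) * a) * poisson_kernel z (cis t)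
        + p * a powr (p - 1) * (poisson_kernel z (cis t) * norm (F (cis t)))
        \<le> poisson_kernel z (cis t) * norm (F (cis t)) powr p"
        by (simp add: algebra_simps)
    qed
    moreover have "p * a powr (p - 1) * (2 * pi * a) \<le> p * a powr (p - 1) * I"
      using aI p by (intro mult_left_mono) auto
    ultimately have "a powr p * (2 * pi) \<le> J" by (simp add: algebra_simps)
    then show ?thesis by (simp add: a_def J_def field_simps)
  qed
qed

text \<open>On the unit circle the numerator of the Poisson kernel is at most 1 and |w - z| is at
  least 1 - |z|.\<close>

lemma norm_powr_le_circle_mean:
  assumes p: "1 \<le> p" and F: "F holomorphic_on ball 0 R" "1 < R" and z: "norm z < 1"
  shows "norm (F z) powr p \<le> circle_mean p F / (1 - norm z)\<^sup>2"
proof -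
  have contF: "continuous_on (sphere 0 1) F"
    using F by (intro holomorphic_on_imp_continuous_on holomorphic_on_subset[OF F(1)]) auto
  have contP: "continuous_on {0..2*pi} (\<lambda>t. poisson_kernel z (cis t))"
    using continuous_on_poisson_kernel[OF z] by (rule continuous_on_compose2) (auto intro!: continuous_intros)
  have int: "((\<lambda>t. 1 / (1 - norm z)\<^sup>2 * norm (F (cis t)) powr p) has_integral 1 / (1 - norm z)\<^sup>2 * (2 * pi * circle_mean p F)) {0..2*pi}"
    using p by (intro has_integral_mult_right circle_mean_has_integral contF) auto
  have "integral {0..2*pi} (\<lambda>t. poisson_kernel z (cis t) * norm (F (cis t)) powr p) \<le> 1 / (1 - norm z)\<^sup>2 * (2 * pi * circle_mean p F)"
  proof (rule has_integral_le[OF integrable_integral int])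
    show "(\<lambda>t. poisson_kernel z (cis t) * norm (F (cis t)) powr p) integrable_on {0..2*pi}"
      using p by (intro integrable_continuous_interval continuous_on_mult contP continuous_on_norm_powr continuous_on_compose_cis contF) auto
    fix t
    have "1 - norm z \<le> norm (cis t - z)" using norm_triangle_ineq2[of "cis t" z] by simp
    then have "(1 - norm z)\<^sup>2 \<le> (norm (cis t - z))\<^sup>2" using z by (intro power_mono) auto
    then have "poisson_kernel z (cis t) \<le> 1 / (1 - norm z)\<^sup>2"
      unfolding poisson_kernel_def using z by (intro frac_le) auto
    then show "poisson_kernel z (cis t) * norm (F (cis t)) powr p \<le> 1 / (1 - norm z)\<^sup>2 * norm (F (cis t)) powr p"
      by (rule mult_right_mono) simp
  qed
  from divide_right_mono[OF this, of "2 * pi"] norm_powr_le_poisson[OF p F z] show ?thesis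
    by simp
qed

text \<open>The two denominators agree because one difference is a rotation of the conjugate of the
  other. Hence the kernel also has integral 2 pi in the angle of its first argument.\<close>

lemma poisson_kernel_swap:
  fixes s :: real
  shows "poisson_kernel (of_real s * cis a) (cis b) = poisson_kernel (of_real s * cis b) (cis a)"
proof -
  have "cis b - of_real s * cis a = cis (a + b) * cnj (cis a - of_real s * cis b)"
    by (simp add: algebra_simps cis_cnj cis_mult flip: mult.assoc)
  then have "norm (cis b - of_real s * cis a) = norm (cis a - of_real s * cis b)"
    by (simp only: norm_mult complex_mod_cnj norm_cis mult_1)
  then show ?thesis by (simp add: poisson_kernel_def norm_mult)
qed

text \<open>Integrate the Poisson-Jensen bound over the inner circle and exchange the integrals. By
  the symmetry of the kernel, the integral over the inner angle is 2 pi.\<close>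

lemma circle_mean_dilate_le:
  fixes s :: real
  assumes p: "1 \<le> p" and F: "F holomorphic_on ball 0 R" "1 < R" and s: "0 \<le> s" "s < 1"
  shows "circle_mean p (\<lambda>z. F (of_real s * z)) \<le> circle_mean p F"
proof -
  let ?I = "cbox 0 (2 * pi)"
  define P where "P = (\<lambda>a b. poisson_kernel (of_real s * cis a) (cis b))"
  define \<Phi> where "\<Phi> = (\<lambda>b. norm (F (cis b)) powr p)"
  have p0: "0 < p" using p by simp
  have contF: "continuous_on (sphere 0 1) F"
    using F by (intro holomorphic_on_imp_continuous_on holomorphic_on_subset[OF F(1)]) auto
  have sn: "norm (of_real s * cis a) < 1" for a using s by (simp add: norm_mult)
  have contFs: "continuous_on (sphere 0 1) (\<lambda>z. F (of_real s * z))"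
    using F s by (intro continuous_on_compose2[OF holomorphic_on_imp_continuous_on[OF F(1)]] continuous_intros)
      (auto simp: norm_mult)
  have "cis b \<noteq> of_real s * cis a" for a b
    using sn[of a] by (metis norm_cis order_less_irrefl)
  then have contP: "continuous_on S (\<lambda>x. P (fst x) (snd x))" for S
    unfolding P_def poisson_kernel_def by (intro continuous_intros) auto
  have cont\<Phi>: "continuous_on S \<Phi>" for S
    unfolding \<Phi>_def by (intro continuous_on_norm_powr p0 continuous_on_compose_cis contF)
  have cont: "continuous_on (cbox (0,0) (2*pi,2*pi)) (\<lambda>(a,b). P a b * \<Phi> b)"
    unfolding case_prod_unfold
    by (intro continuous_on_mult contP continuous_on_compose2[OF cont\<Phi>[of UNIV]] continuous_intros) auto
  have "2 * pi * (2 * pi * circle_mean p (\<lambda>z. F (of_real s * z))) \<le> integral ?I (\<lambda>a. integral ?I (\<lambda>b. P a b * \<Phi> b))"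
  proof (rule has_integral_le[OF has_integral_mult_right integrable_integral])
    show "((\<lambda>t. norm (F (of_real s * cis t)) powr p) has_integral 2 * pi * circle_mean p (\<lambda>z. F (of_real s * z))) ?I"
      using circle_mean_has_integral[OF p0 contFs] by simp
    show "(\<lambda>a. integral ?I (\<lambda>b. P a b * \<Phi> b)) integrable_on ?I"
    proof (intro integrable_continuous integral_continuous_on_param)
      show "continuous_on (?I \<times> ?I) (\<lambda>(a,b). P a b * \<Phi> b)"
        using cont by (simp only: cbox_Pair_eq)
    qed
    fix a
    show "2 * pi * norm (F (of_real s * cis a)) powr p \<le> integral ?I (\<lambda>b. P a b * \<Phi> b)"
      using norm_powr_le_poisson[OF p F sn[of a]] by (simp add: P_def \<Phi>_def field_simps)
  qed
  also have "\<dots> = integral ?I (\<lambda>b. integral ?I (\<lambda>a. P a b * \<Phi> b))"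
    by (rule integral_swap_continuous[OF cont])
  also have "\<dots> = integral ?I (\<lambda>b. 2 * pi * \<Phi> b)"
  proof (intro arg_cong[of _ _ "integral ?I"] ext)
    fix b
    have "((\<lambda>a. P a b) has_integral 2 * pi) ?I"
      using poisson_kernel_integral[OF sn[of b]] by (simp add: P_def poisson_kernel_swap[of s _ b])
    from has_integral_mult_left[OF this, of "\<Phi> b"] show "integral ?I (\<lambda>a. P a b * \<Phi> b) = 2 * pi * \<Phi> b"
      by (rule integral_unique)
  qed
  also have "\<dots> = 2 * pi * (2 * pi * circle_mean p F)"
    using integral_unique[OF circle_mean_has_integral[OF p0 contF]] by (simp add: \<Phi>_def)
  finally show ?thesis by simp
qed

text \<open>Cauchy's coefficient formula on the unit circle, with absolute values inside the
  integral.\<close>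

lemma norm_taylor_coeff_le_circle_mean:
  assumes F: "F holomorphic_on ball 0 R" "1 < R"
  shows "norm (taylor_coeff F k) \<le> circle_mean 1 F"
proof -
  have contF: "continuous_on (cball 0 1) F"
    using F by (intro holomorphic_on_imp_continuous_on holomorphic_on_subset[OF F(1)]) auto
  have hol: "F holomorphic_on ball 0 1" using F by (intro holomorphic_on_subset[OF F(1)]) auto
  have "((\<lambda>u. F u / (u - 0) ^ Suc k) has_contour_integral 2 * pi * \<i> * taylor_coeff F k) (part_circlepath 0 1 0 (2*pi))"
    using Cauchy_has_contour_integral_higher_derivative_circlepath[OF contF hol, of 0 k]
    by (simp add: circlepath_def taylor_coeff_def)
  then have *: "((\<lambda>t. F (cis t) / cis t ^ Suc k * \<i> * cis t) has_integral 2 * pi * \<i> * taylor_coeff F k) {0..2*pi}"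
    by (subst (asm) has_contour_integral_part_circlepath_iff) auto
  have "((\<lambda>t. norm (F (cis t)) powr 1) has_integral 2 * pi * circle_mean 1 F) {0..2*pi}"
    by (intro circle_mean_has_integral continuous_on_subset[OF contF]) auto
  from has_integral_norm_bound_integral_component[OF * this, of 1]
  show ?thesis by (simp add: norm_mult norm_divide norm_power)
qed

subsection \<open>The Hardy norm\<close>

text \<open>Turns each estimate of a norm into one of its p-th power, so that roots need not be
  handled further. For infinite \<open>M\<close> both sides are false.\<close>

lemma enn_root_le_iff:
  assumes "0 < p" "0 \<le> a"
  shows "enn_root p M \<le> ennreal a \<longleftrightarrow> M \<le> ennreal (a powr p)"
proof (cases M)
  case (real m)
  have "m powr (1 / p) \<le> a \<longleftrightarrow> m \<le> a powr p"
  proof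
    assume "m powr (1 / p) \<le> a"
    then have "(m powr (1 / p)) powr p \<le> a powr p" using assms by (intro powr_mono2) auto
    then show "m \<le> a powr p" using assms real by (simp add: powr_powr)
  next
    assume "m \<le> a powr p"
    then have "m powr (1 / p) \<le> (a powr p) powr (1 / p)" using assms real by (intro powr_mono2) auto
    then show "m powr (1 / p) \<le> a" using assms by (simp add: powr_powr)
  qed
  then show ?thesis using real assms by (simp add: enn_root_def)
qed (simp add: enn_root_def top_unique)

text \<open>Convergence to 0 is tested against real bounds \<open>e\<close>; the root trades
  \<open>e\<close> for \<open>e powr p\<close> or \<open>e powr (1/p)\<close>.\<close>

lemma enn_root_tendsto_0_iff:
  assumes "0 < p"
  shows "(\<lambda>n. enn_root p (X n)) \<longlonglongrightarrow> 0 \<longleftrightarrow> X \<longlonglongrightarrow> 0"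
proof -
  have *: "Y \<longlonglongrightarrow> 0 \<longleftrightarrow> (\<forall>e>0. \<forall>\<^sub>F n in sequentially. Y n \<le> ennreal e)" for Y :: "nat \<Rightarrow> ennreal"
  proof
    assume Y: "Y \<longlonglongrightarrow> 0"
    show "\<forall>e>0. \<forall>\<^sub>F n in sequentially. Y n \<le> ennreal e"
    proof (intro allI impI)
      fix e :: real assume "0 < e"
      then show "\<forall>\<^sub>F n in sequentially. Y n \<le> ennreal e"
        using order_tendstoD(2)[OF Y, of "ennreal e"] by (auto elim: eventually_mono)
    qed
  next
    assume *: "\<forall>e>0. \<forall>\<^sub>F n in sequentially. Y n \<le> ennreal e"
    show "Y \<longlonglongrightarrow> 0"
    proof (rule order_tendstoI)
      fix a :: ennreal assume "0 < a"
      then obtain b where b: "0 < b" "b < a" using dense by blast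
      then obtain e where e: "b = ennreal e" "0 < e" by (cases b) auto
      show "\<forall>\<^sub>F n in sequentially. Y n < a"
        using *[rule_format, OF e(2)] b(2) unfolding e(1) by (auto elim: eventually_mono)
    qed simp
  qed
  show ?thesis
  proof
    assume L: "(\<lambda>n. enn_root p (X n)) \<longlonglongrightarrow> 0"
    show "X \<longlonglongrightarrow> 0"
      unfolding *
    proof (intro allI impI)
      fix e :: real assume e: "0 < e"
      then have "\<forall>\<^sub>F n in sequentially. enn_root p (X n) \<le> ennreal (e powr (1/p))"
        using L unfolding * by simp
      then show "\<forall>\<^sub>F n in sequentially. X n \<le> ennreal e"
        using e assms by (simp add: enn_root_le_iff powr_powr)
    qed
  next
    assume R: "X \<longlonglongrightarrow> 0"
    show "(\<lambda>n. enn_root p (X n)) \<longlonglongrightarrow> 0"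
      unfolding *
    proof (intro allI impI)
      fix e :: real assume e: "0 < e"
      then have "\<forall>\<^sub>F n in sequentially. X n \<le> ennreal (e powr p)"
        using R unfolding * by simp
      then show "\<forall>\<^sub>F n in sequentially. enn_root p (X n) \<le> ennreal e"
        using e assms by (simp add: enn_root_le_iff)
    qed
  qed
qed

lemma mult_in_unit_ball:
  fixes u z :: complex
  assumes "norm u < 1" "norm z \<le> 1"
  shows "norm (u * z) < 1"
  using mult_left_mono[OF assms(2), of "norm u"] assms(1) by (simp add: norm_mult)

lemma continuous_on_sphere_dilate:
  fixes f :: "complex \<Rightarrow> complex"
  assumes "continuous_on (ball 0 1) f" "norm u < 1"
  shows "continuous_on (sphere 0 1) (\<lambda>z. f (u * z))"
  using assms(2) by (intro continuous_on_compose2[OF assms(1)] continuous_intros) (auto simp: norm_mult)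

lemma holomorphic_on_dilate:
  assumes "f holomorphic_on ball 0 1" "norm u < 1"
  shows "\<exists>R>1. (\<lambda>z. f (u * z)) holomorphic_on ball 0 R"
proof -
  \<comment> \<open>This radius lies strictly between 1 and 1 / |u|, and it is also defined for u =
    0.\<close>
  define R where "R = 2 / (norm u + 1)"
  have "0 < norm u + 1" by (simp add: add_nonneg_pos)
  then have R: "1 < R" "norm u * R < 1"
    using assms(2) by (simp_all add: R_def less_divide_eq divide_less_eq)
  have "norm (u * z) < 1" if "z \<in> ball 0 R" for z
  proof -
    have "norm (u * z) \<le> norm u * R" using that by (auto simp: norm_mult intro!: mult_left_mono)
    then show ?thesis using R by simp
  qed
  then have "(*) u ` ball 0 R \<subseteq> ball 0 1" by auto
  then have "(\<lambda>z. f (u * z)) holomorphic_on ball 0 R"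
    using holomorphic_on_compose_gen[of "(*) u" "ball 0 R" f "ball 0 1"] assms(1)
    by (simp add: o_def)
  then show ?thesis using R by blast
qed

text \<open>By continuity each integral in the supremum is a real circle mean of a dilate, and a
  supremum is bounded exactly when all its members are. Hardy norms are from here on handled through
  such real bounds.\<close>

lemma hardy_norm_le_iff:
  assumes "0 < p" "0 \<le> a" "continuous_on (ball 0 1) f"
  shows "hardy_norm p f \<le> ennreal a \<longleftrightarrow>
    (\<forall>r\<in>{0<..<1}. circle_mean p (\<lambda>z. f (complex_of_real r * z)) \<le> a powr p)"
proof -
  have "ennreal (1 / (2 * pi)) * (\<integral>\<^sup>+ \<theta>. ennreal (norm (f (complex_of_real r * cis \<theta>)) powr p) * indicator {0..2*pi} \<theta> \<partial>lborel)
     = ennreal (circle_mean p (\<lambda>z. f (complex_of_real r * z)))" if "r \<in> {0<..<1}" for r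
    using that nn_integral_circle_mean[OF assms(1) continuous_on_sphere_dilate[OF assms(3), of r]]
    by (simp flip: ennreal_mult')
  then show ?thesis
    unfolding hardy_norm_def using assms by (auto simp: enn_root_le_iff SUP_le_iff)
qed

lemma hardy_norm_cong:
  "(\<And>z. z \<in> ball 0 1 \<Longrightarrow> f z = g z) \<Longrightarrow> hardy_norm p f = hardy_norm p g"
  unfolding hardy_norm_def
  by (intro arg_cong[of _ _ "enn_root p"] SUP_cong refl arg_cong2[of _ _ _ _ "(*)"] nn_integral_cong)
    (auto simp: norm_mult)

lemma hardy_norm_add_le:
  assumes p: "1 \<le> p" and f: "continuous_on (ball 0 1) f" and g: "continuous_on (ball 0 1) g"
    and "0 < a" "0 < b" "hardy_norm p f \<le> ennreal a" "hardy_norm p g \<le> ennreal b"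
  shows "hardy_norm p (\<lambda>z. f z + g z) \<le> ennreal (a + b)"
  using assms
  by (subst hardy_norm_le_iff)
    (auto simp: hardy_norm_le_iff simp del: ennreal_plus intro!: continuous_on_add circle_mean_minkowski continuous_on_sphere_dilate)

lemma hardy_norm_add:
  assumes p: "1 \<le> p" and f: "continuous_on (ball 0 1) f" and g: "continuous_on (ball 0 1) g"
  shows "hardy_norm p (\<lambda>z. f z + g z) \<le> hardy_norm p f + hardy_norm p g"
proof (rule ennreal_le_epsilon)
  fix e :: real
  assume fin: "hardy_norm p f + hardy_norm p g < top" and e: "0 < e"
  obtain a where a: "hardy_norm p f = ennreal a" "0 \<le> a" using fin by (cases "hardy_norm p f") auto
  obtain b where b: "hardy_norm p g = ennreal b" "0 \<le> b" using fin by (cases "hardy_norm p g") auto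
  \<comment> \<open>The surplus \<open>e/2\<close> makes both bounds strictly positive even when a
    norm vanishes.\<close>
  have "hardy_norm p f \<le> ennreal (a + e/2)" "hardy_norm p g \<le> ennreal (b + e/2)" using a b e by (auto intro!: ennreal_leI)
  then have "hardy_norm p (\<lambda>z. f z + g z) \<le> ennreal ((a + e/2) + (b + e/2))"
    using a b e by (intro hardy_norm_add_le p f g) auto
  moreover have split: "ennreal ((a + e/2) + (b + e/2)) = ennreal a + ennreal b + ennreal e"
    using a b e by (simp flip: ennreal_plus)
  ultimately show "hardy_norm p (\<lambda>z. f z + g z) \<le> hardy_norm p f + hardy_norm p g + ennreal e"
    using a b by simp
qed

lemma hardy_norm_cmult_le:
  assumes "0 < p" "continuous_on (ball 0 1) f" "0 \<le> a" "hardy_norm p f \<le> ennreal a"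
  shows "hardy_norm p (\<lambda>z. c * f z) \<le> ennreal (norm c * a)"
  using assms
  by (auto simp: hardy_norm_le_iff continuous_on_mult circle_mean_cmult powr_mult intro!: mult_left_mono)

lemma hardy_norm_le_bound:
  assumes "0 < p" "continuous_on (ball 0 1) f" "0 \<le> a" "\<And>z. z \<in> ball 0 1 \<Longrightarrow> norm (f z) \<le> a"
  shows "hardy_norm p f \<le> ennreal a"
  using assms
  by (auto simp: hardy_norm_le_iff norm_mult intro!: circle_mean_le_const continuous_on_sphere_dilate)

text \<open>The Hardy norm sees only radii below 1. The dilate is continuous on the closed disk, so
  its mean over the unit circle is the limit of the means at radius \<open>s\<close> as
  \<open>s\<close> tends to 1.\<close>

lemma circle_mean_dilate_le_hardy_norm:
  assumes p: "0 < p" "0 \<le> a" and f: "continuous_on (ball 0 1) f" and u: "norm u < 1"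
    and le: "hardy_norm p (\<lambda>z. f (u * z)) \<le> ennreal a"
  shows "circle_mean p (\<lambda>z. f (u * z)) \<le> a powr p"
proof -
  have cont: "continuous_on {0..1} (\<lambda>s. integral (cbox 0 (2*pi)) (\<lambda>t. norm (f (u * (of_real s * cis t))) powr p))"
  proof (intro integral_continuous_on_param)
    have "continuous_on ({0..1} \<times> cbox 0 (2*pi)) (\<lambda>x. norm (f (u * (of_real (fst x) * cis (snd x)))) powr p)"
    proof (intro continuous_on_norm_powr p continuous_on_compose2[OF f] continuous_intros)
      have "norm (u * (of_real s * cis t)) < 1" if "0 \<le> s" "s \<le> 1" for s t
        using mult_left_mono[of s 1 "norm u"] that u by (simp add: norm_mult)
      then show "(\<lambda>x. u * (of_real (fst x) * cis (snd x))) ` ({0..1} \<times> cbox 0 (2*pi)) \<subseteq> ball 0 1"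
        by auto
    qed
    then show "continuous_on ({0..1} \<times> cbox 0 (2*pi)) (\<lambda>(s, t). norm (f (u * (of_real s * cis t))) powr p)"
      by (simp add: case_prod_unfold)
  qed
  have contu: "continuous_on (ball 0 1) (\<lambda>z. f (u * z))"
  proof (intro continuous_on_compose2[OF f] continuous_intros)
    show "(*) u ` ball 0 1 \<subseteq> ball 0 1"
      using mult_in_unit_ball[OF u] by (auto simp: less_imp_le)
  qed
  have lim: "((\<lambda>s. circle_mean p (\<lambda>z. f (u * (complex_of_real s * z)))) \<longlongrightarrow> circle_mean p (\<lambda>z. f (u * (complex_of_real 1 * z)))) (at 1 within {0..1})"
    using cont[unfolded continuous_on_def, rule_format, of 1] unfolding circle_mean_def
    by (intro tendsto_divide) (auto simp: cbox_interval)
  have "at (1::real) within {0..1} \<noteq> bot" by (simp add: trivial_limit_within islimpt_Icc)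
  moreover have "\<forall>\<^sub>F s in at (1::real) within {0..1}. circle_mean p (\<lambda>z. f (u * (complex_of_real s * z))) \<le> a powr p"
  proof -
    have "\<forall>\<^sub>F s in at (1::real) within {0..1}. s \<in> {0<..<1}"
      unfolding eventually_at by (intro exI[of _ 1]) (auto simp: dist_real_def)
    then show ?thesis
      using le by (elim eventually_mono) (auto simp: hardy_norm_le_iff[OF p contu])
  qed
  ultimately show ?thesis using tendsto_upperbound[OF lim] by simp
qed

text \<open>The converse bound: the dilate is holomorphic beyond the unit circle, so its means over
  smaller circles are at most the mean over the unit circle.\<close>

lemma hardy_norm_dilate_le:
  assumes p: "1 \<le> p" and f: "f holomorphic_on ball 0 1" and u: "norm u < 1"
  shows "hardy_norm p (\<lambda>z. f (u * z)) \<le> ennreal (circle_mean p (\<lambda>z. f (u * z)) powr (1 / p))"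
proof -
  obtain R where R: "1 < R" "(\<lambda>z. f (u * z)) holomorphic_on ball 0 R"
    using holomorphic_on_dilate[OF f u] by blast
  then have "continuous_on (ball 0 1) (\<lambda>z. f (u * z))"
    by (intro holomorphic_on_imp_continuous_on holomorphic_on_subset[OF R(2)]) auto
  then show ?thesis
    using p circle_mean_dilate_le[OF p R(2,1)] by (auto simp: hardy_norm_le_iff powr_powr circle_mean_nonneg)
qed

text \<open>Point evaluations are bounded uniformly on compact subsets of the disk. This makes
  convergence in norm locally uniform.\<close>

lemma hardy_norm_point_bound:
  assumes p: "1 \<le> p" and \<rho>: "0 \<le> \<rho>" "\<rho> < 1"
  obtains K where "0 < K" "\<And>f a z. f holomorphic_on ball 0 1 \<Longrightarrow> 0 \<le> a \<Longrightarrow> hardy_norm p f \<le> ennreal a \<Longrightarrow>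
    norm z \<le> \<rho> \<Longrightarrow> norm (f z) \<le> K * a"
proof -
  \<comment> \<open>A radius strictly between \<rho> and 1: the dilate by \<open>r\<close> is
    holomorphic across the unit circle, and \<open>z / r\<close> stays in the disk of radius \<rho>
    / r, where the kernel estimate applies.\<close>
  define r where "r = (1 + \<rho>) / 2"
  have r: "0 < r" "r < 1" "\<rho> < r" using \<rho> by (auto simp: r_def)
  define K where "K = (1 / (1 - \<rho> / r)\<^sup>2) powr (1 / p)"
  have d: "0 < 1 - \<rho> / r" using r by simp
  have "norm (f z) \<le> K * a" if f: "f holomorphic_on ball 0 1" and a: "0 \<le> a" and le: "hardy_norm p f \<le> ennreal a"
    and z: "norm z \<le> \<rho>" for f a z
  proof -
    obtain R where R: "1 < R" "(\<lambda>z. f (of_real r * z)) holomorphic_on ball 0 R"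
      using holomorphic_on_dilate[OF f, of "of_real r"] r by auto
    have cm: "circle_mean p (\<lambda>z. f (of_real r * z)) \<le> a powr p"
      using le p a r holomorphic_on_imp_continuous_on[OF f] by (simp add: hardy_norm_le_iff)
    have nz: "norm (z / of_real r) \<le> \<rho> / r" using z r by (simp add: norm_divide divide_right_mono)
    have "norm (f z) powr p \<le> circle_mean p (\<lambda>z. f (of_real r * z)) / (1 - norm (z / of_real r))\<^sup>2"
      using norm_powr_le_circle_mean[OF p R(2,1) le_less_trans[OF nz]] d r by simp
    also have "\<dots> \<le> a powr p / (1 - \<rho> / r)\<^sup>2"
      using cm nz d zero_less_power[OF d, of 2] by (intro frac_le power_mono) auto
    finally have "(norm (f z) powr p) powr (1/p) \<le> (a powr p / (1 - \<rho> / r)\<^sup>2) powr (1/p)"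
      using p by (intro powr_mono2) auto
    also have "\<dots> = (a powr p * (1 / (1 - \<rho> / r)\<^sup>2)) powr (1/p)" by simp
    also have "\<dots> = a * K" unfolding powr_mult K_def using a p by (simp add: powr_powr)
    finally show ?thesis using p by (simp add: powr_powr mult.commute)
  qed
  moreover have "0 < K" using d r by (simp add: K_def)
  ultimately show ?thesis using that by blast
qed

lemma taylor_coeff_dilate:
  assumes "f holomorphic_on ball 0 1" "norm u < 1"
  shows "taylor_coeff (\<lambda>z. f (u * z)) k = u ^ k * taylor_coeff f k"
proof -
  have "u * w \<in> ball 0 1" if "w \<in> ball 0 1" for w
    using that mult_in_unit_ball[OF assms(2)] by (simp add: less_imp_le)
  then show ?thesis
    using higher_deriv_compose_linear[OF assms(1), of "ball 0 1" 0 u k] by (simp add: taylor_coeff_def)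
qed

text \<open>Apply the coefficient bound to the dilate by \<open>r\<close>, whose k-th coefficient
  gains the factor \<open>r ^ k\<close>, and let \<open>r\<close> tend to 1.\<close>

lemma norm_taylor_coeff_le_hardy_norm:
  assumes p: "1 \<le> p" and f: "f holomorphic_on ball 0 1" and a: "0 < a" and le: "hardy_norm p f \<le> ennreal a"
  shows "norm (taylor_coeff f k) \<le> 2 * a"
proof -
  have *: "r ^ k * norm (taylor_coeff f k) \<le> 2 * a" if r: "r \<in> {0<..<1}" for r
  proof -
    have rn: "norm (complex_of_real r) < 1" using r by simp
    obtain R where R: "1 < R" "(\<lambda>z. f (of_real r * z)) holomorphic_on ball 0 R"
      using holomorphic_on_dilate[OF f rn] by auto
    have contf: "continuous_on (ball 0 1) f" using f by (rule holomorphic_on_imp_continuous_on)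
    have "r ^ k * norm (taylor_coeff f k) = norm (taylor_coeff (\<lambda>z. f (of_real r * z)) k)"
      using taylor_coeff_dilate[OF f rn] r by (simp add: norm_mult norm_power)
    also have "\<dots> \<le> circle_mean 1 (\<lambda>z. f (of_real r * z))" by (rule norm_taylor_coeff_le_circle_mean[OF R(2,1)])
    also have "\<dots> \<le> 2 * a"
      using le p a r contf continuous_on_sphere_dilate[OF contf rn]
      by (intro circle_mean_1_le[OF p]) (auto simp: hardy_norm_le_iff)
    finally show ?thesis .
  qed
  have "((\<lambda>r. r ^ k * norm (taylor_coeff f k)) \<longlongrightarrow> 1 ^ k * norm (taylor_coeff f k)) (at_left 1)"
    by (intro tendsto_intros)
  moreover have "\<forall>\<^sub>F r in at_left (1::real). r ^ k * norm (taylor_coeff f k) \<le> 2 * a"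
    using eventually_at_left_real[of 0 1] by (rule eventually_mono) (use * in auto)
  ultimately show ?thesis
    using tendsto_upperbound[of "\<lambda>r. r ^ k * norm (taylor_coeff f k)" "1 ^ k * norm (taylor_coeff f k)" "at_left 1" "2 * a"]
    by simp
qed

subsection \<open>Uniform boundedness\<close>

text \<open>If the conclusion fails, there are nested balls \<open>{w. N (w - X k) \<le> r k}\<close> such that some \<open>q n\<close>
  is at least \<open>k\<close> on the ball number \<open>k + 1\<close>; a common point contradicts pointwise boundedness.
  Completeness is only assumed in the form in which it yields that point.\<close>
lemma uniform_boundedness_seminorms:
  fixes V :: "('a \<Rightarrow> 'b::real_vector) set" and N :: "('a \<Rightarrow> 'b) \<Rightarrow> real" and q :: "nat \<Rightarrow> ('a \<Rightarrow> 'b) \<Rightarrow> real"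
  assumes V_add: "\<And>f g. f \<in> V \<Longrightarrow> g \<in> V \<Longrightarrow> (\<lambda>x. f x + g x) \<in> V"
    and V_scale: "\<And>c f. f \<in> V \<Longrightarrow> (\<lambda>x. c *\<^sub>R f x) \<in> V"
    and N_nonneg: "\<And>f. 0 \<le> N f"
    and N_add: "\<And>f g. f \<in> V \<Longrightarrow> g \<in> V \<Longrightarrow> N (\<lambda>x. f x + g x) \<le> N f + N g"
    and N_scale: "\<And>c f. f \<in> V \<Longrightarrow> N (\<lambda>x. c *\<^sub>R f x) \<le> \<bar>c\<bar> * N f"
    and q_add: "\<And>n f g. f \<in> V \<Longrightarrow> g \<in> V \<Longrightarrow> q n (\<lambda>x. f x + g x) \<le> q n f + q n g"
    and q_scale: "\<And>n c f. f \<in> V \<Longrightarrow> q n (\<lambda>x. c *\<^sub>R f x) \<le> \<bar>c\<bar> * q n f"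
    and q_le: "\<And>n f. f \<in> V \<Longrightarrow> q n f \<le> B n * N f"
    and pointwise: "\<And>f. f \<in> V \<Longrightarrow> \<exists>K. \<forall>n. q n f \<le> K"
    and complete: "\<And>X e. (\<And>k. X k \<in> V) \<Longrightarrow> (\<And>m n. m \<le> n \<Longrightarrow> N (\<lambda>x. X n x - X m x) \<le> e m) \<Longrightarrow>
        e \<longlonglongrightarrow> 0 \<Longrightarrow> \<exists>f\<in>V. \<forall>m. N (\<lambda>x. f x - X m x) \<le> e m"
  shows "\<exists>C>0. \<forall>n. \<forall>f\<in>V. q n f \<le> C * N f"
proof (rule ccontr)
  assume "\<not> ?thesis"
  then have unb: "\<exists>n. \<exists>f\<in>V. C * N f < q n f" if "0 < C" for C
    using that by (meson not_le)
  have V_diff: "(\<lambda>x. f x - g x) \<in> V" if "f \<in> V" "g \<in> V" for f g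
    using V_add[OF that(1) V_scale[OF that(2), of "-1"]] by simp
  have q_diff: "q n f \<le> q n g + q n (\<lambda>x. g x - f x)" if "f \<in> V" "g \<in> V" for n f g
    using q_add[OF that(2) V_scale[OF V_diff[OF that(2,1)], of "-1"], of n] q_scale[OF V_diff[OF that(2,1)], of n "-1"]
    by simp
  have step: "\<exists>y s. y \<in> V \<and> 0 < s \<and> N (\<lambda>t. y t - x t) \<le> r / 2 \<and> s \<le> r / 2 \<and>
      (\<exists>n. \<forall>w\<in>V. N (\<lambda>t. w t - y t) \<le> s \<longrightarrow> real j \<le> q n w)" if x: "x \<in> V" and r: "0 < r" for x r j
  proof -
    obtain K0 where K0: "\<And>n. q n x \<le> K0" using pointwise[OF x] by blast
    define K where "K = max 0 K0"
    have K: "0 \<le> K" "q n x \<le> K" for n using K0[of n] by (auto simp: K_def)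
    \<comment> \<open>A function with q n f > (2 M / r) N f, rescaled to size r / 2, has q n > M.
      Adding it to \<open>x\<close> costs at most \<open>K\<close>, so \<open>q n\<close> is still
      at least j + 1 at the new center.\<close>
    define M where "M = K + real j + 1"
    have M: "0 < M" using K(1) by (simp add: M_def)
    obtain n f where f: "f \<in> V" and nf: "2 * M / r * N f < q n f" using unb[of "2 * M / r"] M r by auto
    have "N f \<noteq> 0"
    proof
      assume "N f = 0"
      then show False using nf q_le[OF f, of n] by simp
    qed
    with N_nonneg[of f] have Nf: "0 < N f" by simp
    define c where "c = r / (2 * N f)"
    have c: "0 < c" using r Nf by (simp add: c_def)
    define \<xi> where "\<xi> = (\<lambda>t. c *\<^sub>R f t)"
    have \<xi>: "\<xi> \<in> V" unfolding \<xi>_def by (rule V_scale[OF f])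
    have N\<xi>: "N \<xi> \<le> r / 2" using N_scale[OF f, of c] c Nf r by (simp add: \<xi>_def c_def)
    have "M < c * q n f" using nf Nf r by (simp add: c_def field_simps)
    also have "q n f \<le> 1 / c * q n \<xi>" using q_scale[OF \<xi>, of n "1 / c"] c by (simp add: \<xi>_def)
    then have "c * q n f \<le> q n \<xi>" using c by (simp add: field_simps)
    finally have q\<xi>: "M < q n \<xi>" .
    define y where "y = (\<lambda>t. x t + \<xi> t)"
    have y: "y \<in> V" unfolding y_def by (rule V_add[OF x \<xi>])
    have "q n \<xi> \<le> q n y + q n x"
      using q_diff[OF \<xi> y, of n] by (simp add: y_def)
    with q\<xi> K(2)[of n] have qy: "real j + 1 \<le> q n y" by (simp add: M_def)
    \<comment> \<open>Within distance \<open>s\<close> of \<open>y\<close> the value of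
      \<open>q n\<close> drops by at most 1, from j + 1 to j.\<close>
    define s where "s = min (r / 2) (1 / (\<bar>B n\<bar> + 1))"
    have s: "0 < s" using r by (simp add: s_def)
    have "real j \<le> q n w" if w: "w \<in> V" and Nw: "N (\<lambda>t. w t - y t) \<le> s" for w
    proof -
      have "B n * N (\<lambda>t. w t - y t) \<le> \<bar>B n\<bar> * s"
        using Nw N_nonneg s by (intro mult_mono) auto
      also have "\<dots> \<le> \<bar>B n\<bar> * (1 / (\<bar>B n\<bar> + 1))" unfolding s_def by (intro mult_left_mono) auto
      also have "\<dots> \<le> 1" by simp
      finally have "q n (\<lambda>t. w t - y t) \<le> 1" using q_le[OF V_diff[OF w y], of n] by simp
      then show ?thesis using q_diff[OF y w, of n] qy by simp
    qed
    moreover have "(\<lambda>t. y t - x t) = \<xi>" by (simp add: y_def)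
    ultimately show ?thesis using y s N\<xi> by (intro exI[of _ y] exI[of _ s]) (auto simp: s_def)
  qed
  obtain f0 where f0: "f0 \<in> V" using unb[of 1] by auto
  have "\<exists>S. \<forall>k. (fst (S k) \<in> V \<and> 0 < snd (S k)) \<and>
      (N (\<lambda>t. fst (S (Suc k)) t - fst (S k) t) \<le> snd (S k) / 2 \<and> snd (S (Suc k)) \<le> snd (S k) / 2 \<and>
       (\<exists>n. \<forall>w\<in>V. N (\<lambda>t. w t - fst (S (Suc k)) t) \<le> snd (S (Suc k)) \<longrightarrow> real k \<le> q n w))"
  proof (rule dependent_nat_choice)
    show "\<exists>x. fst x \<in> V \<and> 0 < (snd x :: real)" using f0 by (intro exI[of _ "(f0, 1)"]) simp
    fix x :: "('a \<Rightarrow> 'b) \<times> real" and k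
    assume "fst x \<in> V \<and> 0 < snd x"
    then obtain y s where "y \<in> V \<and> 0 < s \<and> N (\<lambda>t. y t - fst x t) \<le> snd x / 2 \<and> s \<le> snd x / 2 \<and>
      (\<exists>n. \<forall>w\<in>V. N (\<lambda>t. w t - y t) \<le> s \<longrightarrow> real k \<le> q n w)"
      using step[of "fst x" "snd x" k] by blast
    then show "\<exists>y. (fst y \<in> V \<and> 0 < snd y) \<and> N (\<lambda>t. fst y t - fst x t) \<le> snd x / 2 \<and>
        snd y \<le> snd x / 2 \<and> (\<exists>n. \<forall>w\<in>V. N (\<lambda>t. w t - fst y t) \<le> snd y \<longrightarrow> real k \<le> q n w)"
      by (intro exI[of _ "(y, s)"]) simp
  qed
  then obtain S where S: "\<And>k. fst (S k) \<in> V \<and> 0 < snd (S k) \<and>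
       N (\<lambda>t. fst (S (Suc k)) t - fst (S k) t) \<le> snd (S k) / 2 \<and> snd (S (Suc k)) \<le> snd (S k) / 2 \<and>
       (\<exists>n. \<forall>w\<in>V. N (\<lambda>t. w t - fst (S (Suc k)) t) \<le> snd (S (Suc k)) \<longrightarrow> real k \<le> q n w)"
    by blast
  define X r where "X = (\<lambda>k. fst (S k))" and "r = (\<lambda>k. snd (S k))"
  have X: "X k \<in> V" and r0: "0 < r k" and NX: "N (\<lambda>t. X (Suc k) t - X k t) \<le> r k / 2"
    and r_Suc: "r (Suc k) \<le> r k / 2"
    and large: "\<exists>n. \<forall>w\<in>V. N (\<lambda>t. w t - X (Suc k) t) \<le> r (Suc k) \<longrightarrow> real k \<le> q n w" for k
    using S[of k] by (auto simp: X_def r_def)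
  \<comment> \<open>Telescoping: radii at least halve, so r n - r (n + 1) \<ge> r n / 2 pays for the
    step from center n to center n + 1.\<close>
  have "N (\<lambda>t. X n t - X m t) \<le> r m - r n" if "m \<le> n" for m n
    using that
  proof (induction n rule: dec_induct)
    case base
    then show ?case using N_scale[OF X, of 0] by simp
  next
    case (step n)
    then show ?case
      using N_add[OF V_diff[OF X[of n] X[of m]] V_diff[OF X[of "Suc n"] X[of n]]] NX[of n] r_Suc[of n]
      by simp
  qed
  then have "N (\<lambda>t. X n t - X m t) \<le> r m" if "m \<le> n" for m n
    using that r0[of n] by force
  moreover have "r \<longlonglongrightarrow> 0"
  proof (rule tendsto_sandwich[of "\<lambda>_. 0"])
    have "r k \<le> r 0 * (1/2)^k" for k
    proof (induction k)
      case (Suc k)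
      then show ?case using r_Suc[of k] by simp
    qed simp
    then show "\<forall>\<^sub>F k in sequentially. r k \<le> r 0 * (1/2)^k" by simp
    show "(\<lambda>k. r 0 * (1/2)^k) \<longlonglongrightarrow> 0" by (intro tendsto_mult_right_zero LIMSEQ_power_zero) auto
  qed (use r0 in \<open>auto simp: less_imp_le\<close>)
  ultimately obtain f where f: "f \<in> V" "\<And>m. N (\<lambda>t. f t - X m t) \<le> r m"
    using complete[of X r] X by blast
  obtain K where K: "\<And>n. q n f \<le> K" using pointwise[OF f(1)] by blast
  obtain k :: nat where k: "K < real k" using reals_Archimedean2 by blast
  show False using large[of k] f K k by (meson less_le_trans not_le order_trans)
qed

subsection \<open>Completeness of the Hardy space\<close>

lemma hardy_spaceD:
  assumes "f \<in> hardy_space p"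
  shows "f holomorphic_on ball 0 1" "continuous_on (ball 0 1) f" "hardy_norm p f = ennreal (enn2real (hardy_norm p f))"
  using assms by (auto simp: hardy_space_def holomorphic_on_imp_continuous_on)

lemma hardy_spaceI:
  "f holomorphic_on ball 0 1 \<Longrightarrow> hardy_norm p f \<le> ennreal a \<Longrightarrow> f \<in> hardy_space p"
  by (auto simp: hardy_space_def less_top[symmetric] top_unique)

lemma hardy_space_add:
  assumes "1 \<le> p" "f \<in> hardy_space p" "g \<in> hardy_space p"
  shows "(\<lambda>z. f z + g z) \<in> hardy_space p"
    and "enn2real (hardy_norm p (\<lambda>z. f z + g z)) \<le> enn2real (hardy_norm p f) + enn2real (hardy_norm p g)"
proof -
  have "hardy_norm p (\<lambda>z. f z + g z) \<le> ennreal (enn2real (hardy_norm p f) + enn2real (hardy_norm p g))"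
    using hardy_norm_add[OF assms(1), of f g] hardy_spaceD[OF assms(2)] hardy_spaceD[OF assms(3)]
    by (simp add: ennreal_plus)
  then show "(\<lambda>z. f z + g z) \<in> hardy_space p"
    "enn2real (hardy_norm p (\<lambda>z. f z + g z)) \<le> enn2real (hardy_norm p f) + enn2real (hardy_norm p g)"
    using hardy_spaceD[OF assms(2)] hardy_spaceD[OF assms(3)]
    by (auto intro!: hardy_spaceI holomorphic_intros enn2real_leI simp del: ennreal_plus)
qed

lemma hardy_space_cmult:
  assumes "1 \<le> p" "f \<in> hardy_space p"
  shows "(\<lambda>z. c * f z) \<in> hardy_space p"
    and "enn2real (hardy_norm p (\<lambda>z. c * f z)) \<le> norm c * enn2real (hardy_norm p f)"
proof -
  have "hardy_norm p (\<lambda>z. c * f z) \<le> ennreal (norm c * enn2real (hardy_norm p f))"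
    using assms hardy_spaceD[OF assms(2)] by (intro hardy_norm_cmult_le) auto
  then show "(\<lambda>z. c * f z) \<in> hardy_space p"
    "enn2real (hardy_norm p (\<lambda>z. c * f z)) \<le> norm c * enn2real (hardy_norm p f)"
    using hardy_spaceD[OF assms(2)]
    by (auto intro!: hardy_spaceI holomorphic_intros enn2real_leI)
qed

text \<open>Taking p-th roots first reduces this to the additive epsilon principle, including the
  case c = 0.\<close>

lemma le_powr_epsilon:
  fixes x c p :: real
  assumes "0 < p" "0 \<le> c" "0 \<le> x" "\<And>e. 0 < e \<Longrightarrow> x \<le> (c + e) powr p"
  shows "x \<le> c powr p"
proof -
  have "x powr (1 / p) \<le> c"
  proof (rule field_le_epsilon)
    fix e :: real assume e: "0 < e"
    have "x powr (1 / p) \<le> ((c + e) powr p) powr (1 / p)"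
      using assms e by (intro powr_mono2) auto
    then show "x powr (1 / p) \<le> c + e" using assms e by (simp add: powr_powr)
  qed
  then have "(x powr (1 / p)) powr p \<le> c powr p" using assms by (intro powr_mono2) auto
  then show ?thesis using assms by (simp add: powr_powr)
qed

text \<open>Bounded point evaluations make a Cauchy sequence locally uniformly Cauchy, so it has a
  holomorphic limit. The norm bounds pass to the limit circle by circle.\<close>

lemma hardy_space_complete:
  assumes p: "1 \<le> p" and X: "\<And>k. X k \<in> hardy_space p"
    and Cauchy: "\<And>m n. m \<le> n \<Longrightarrow> enn2real (hardy_norm p (\<lambda>z. X n z - X m z)) \<le> e m"
    and e: "e \<longlonglongrightarrow> 0"
  shows "\<exists>f\<in>hardy_space p. \<forall>m. enn2real (hardy_norm p (\<lambda>z. f z - X m z)) \<le> e m"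
proof -
  have p0: "0 < p" using p by simp
  have diff: "(\<lambda>z. X n z - X m z) \<in> hardy_space p" for m n
    using hardy_space_add(1)[OF p X[of n] hardy_space_cmult(1)[OF p X[of m], of "-1"]] by simp
  have e0: "0 \<le> e m" for m using Cauchy[of m m] enn2real_nonneg order_trans by blast
  have le: "hardy_norm p (\<lambda>z. X n z - X m z) \<le> ennreal (e m)" if "m \<le> n" for m n
    by (subst hardy_spaceD(3)[OF diff]) (intro ennreal_leI Cauchy that)
  define f where "f = (\<lambda>z. lim (\<lambda>n. X n z))"
  have ulim: "uniform_limit (cball 0 \<rho>) X f sequentially" if \<rho>: "0 \<le> \<rho>" "\<rho> < 1" for \<rho>
  proof -
    obtain K where K: "0 < K" "\<And>f a z. f holomorphic_on ball 0 1 \<Longrightarrow> 0 \<le> a \<Longrightarrow> hardy_norm p f \<le> ennreal a \<Longrightarrow>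
        norm z \<le> \<rho> \<Longrightarrow> norm (f z) \<le> K * a"
      using hardy_norm_point_bound[OF p \<rho>] by blast
    have "uniformly_Cauchy_on (cball 0 \<rho>) X"
    proof (rule uniformly_Cauchy_onI')
      fix \<epsilon> :: real assume \<epsilon>: "0 < \<epsilon>"
      have "\<forall>\<^sub>F m in sequentially. e m < \<epsilon> / K" using order_tendstoD(2)[OF e, of "\<epsilon> / K"] \<epsilon> K by simp
      then obtain M where M: "\<And>m. M \<le> m \<Longrightarrow> e m < \<epsilon> / K" by (auto simp: eventually_sequentially)
      show "\<exists>M. \<forall>x\<in>cball 0 \<rho>. \<forall>m\<ge>M. \<forall>n>m. dist (X m x) (X n x) < \<epsilon>"
      proof (intro exI[of _ M] ballI allI impI)
        fix x m n assume x: "x \<in> cball (0::complex) \<rho>" and mn: "M \<le> m" "m < n"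
        have "norm (X n x - X m x) \<le> K * e m"
          using K(2)[OF hardy_spaceD(1)[OF diff] e0 le] x mn by simp
        also have "\<dots> < \<epsilon>" using M[OF mn(1)] K(1) by (simp add: field_simps)
        finally show "dist (X m x) (X n x) < \<epsilon>" by (simp add: dist_norm norm_minus_commute)
      qed
    qed
    then show ?thesis unfolding f_def
      by (simp add: Cauchy_uniformly_convergent flip: uniformly_convergent_uniform_limit_iff)
  qed
  have holf: "f holomorphic_on ball 0 1"
  proof (rule holomorphic_uniform_sequence)
    fix x :: complex assume x: "x \<in> ball 0 1"
    \<comment> \<open>Half the distance to the unit circle, so the disk about \<open>x\<close> fits
      into a centered disk of radius below 1.\<close>
    define d where "d = (1 - norm x) / 2"
    have "cball x d \<subseteq> cball 0 (norm x + d)"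
      by (auto simp: dist_norm) (metis add_left_mono norm_minus_commute norm_triangle_sub order_trans)
    moreover have "norm x + d < 1" "0 < d" using x by (auto simp: d_def field_simps)
    moreover from this have "cball 0 (norm x + d) \<subseteq> ball (0::complex) 1" by auto
    ultimately show "\<exists>d>0. cball x d \<subseteq> ball 0 1 \<and> uniform_limit (cball x d) X f sequentially"
      using ulim[of "norm x + d"] by (intro exI[of _ d]) (auto intro: uniform_limit_on_subset)
  qed (use X hardy_spaceD in auto)
  have contf: "continuous_on (ball 0 1) f" using holf by (rule holomorphic_on_imp_continuous_on)
  note contX = hardy_spaceD(2)[OF X]
  have lef: "hardy_norm p (\<lambda>z. f z - X m z) \<le> ennreal (e m)" for m
  proof (subst hardy_norm_le_iff[OF p0 e0 continuous_on_diff[OF contf contX]], intro ballI)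
    fix r :: real assume r: "r \<in> {0<..<1}"
    then have rn: "norm (complex_of_real r) < 1" by simp
    show "circle_mean p (\<lambda>z. f (of_real r * z) - X m (of_real r * z)) \<le> e m powr p"
    proof (rule le_powr_epsilon[OF p0 e0 circle_mean_nonneg])
      fix \<epsilon> :: real assume \<epsilon>: "0 < \<epsilon>"
      have "\<forall>\<^sub>F n in sequentially. (\<forall>z\<in>cball 0 r. dist (X n z) (f z) < \<epsilon> / 2) \<and> m \<le> n"
        using uniform_limitD[OF ulim[of r], of "\<epsilon> / 2"] r \<epsilon> eventually_ge_at_top[of m]
        by (auto intro: eventually_conj)
      from eventually_happens[OF this]
      obtain n where n: "\<And>z. z \<in> cball 0 r \<Longrightarrow> dist (X n z) (f z) < \<epsilon> / 2" "m \<le> n"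
        using sequentially_bot by blast
      \<comment> \<open>Split f - X m at a late X n: the first part is uniformly small on the circle
        of radius \<open>r\<close>, the second is bounded by \<open>e m\<close>. Adding \<epsilon> /
        2 to \<open>e m\<close> keeps the bound positive for Minkowski.\<close>
      have "circle_mean p (\<lambda>z. (f (of_real r * z) - X n (of_real r * z)) + (X n (of_real r * z) - X m (of_real r * z)))
          \<le> (\<epsilon> / 2 + (e m + \<epsilon> / 2)) powr p"
      proof (rule circle_mean_minkowski[OF p])
        show c1: "continuous_on (sphere 0 1) (\<lambda>z. f (of_real r * z) - X n (of_real r * z))"
          "continuous_on (sphere 0 1) (\<lambda>z. X n (of_real r * z) - X m (of_real r * z))"
          by (intro continuous_on_diff continuous_on_sphere_dilate contf contX rn)+
        show "circle_mean p (\<lambda>z. f (of_real r * z) - X n (of_real r * z)) \<le> (\<epsilon> / 2) powr p"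
        proof (rule circle_mean_le_const[OF p0 c1(1)])
          fix z :: complex assume "norm z = 1"
          then show "norm (f (of_real r * z) - X n (of_real r * z)) \<le> \<epsilon> / 2"
            using n(1)[of "of_real r * z"] r by (simp add: dist_norm norm_minus_commute norm_mult)
        qed
        have "circle_mean p (\<lambda>z. X n (of_real r * z) - X m (of_real r * z)) \<le> e m powr p"
          using le[OF n(2)] r hardy_norm_le_iff[OF p0 e0 continuous_on_diff[OF contX contX]] by blast
        also have "\<dots> \<le> (e m + \<epsilon> / 2) powr p" using e0 \<epsilon> p by (intro powr_mono2) auto
        finally show "circle_mean p (\<lambda>z. X n (of_real r * z) - X m (of_real r * z)) \<le> (e m + \<epsilon> / 2) powr p" .
      qed (use \<epsilon> e0[of m] in auto)
      then show "circle_mean p (\<lambda>z. f (of_real r * z) - X m (of_real r * z)) \<le> (e m + \<epsilon>) powr p"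
        by (simp add: ac_simps)
    qed
  qed
  have "(\<lambda>z. f z - X 0 z) \<in> hardy_space p"
    using holf hardy_spaceD(1)[OF X] by (intro hardy_spaceI[OF _ lef] holomorphic_intros) auto
  from hardy_space_add(1)[OF p this X[of 0]] have "f \<in> hardy_space p" by simp
  then show ?thesis using lef e0 by (intro bexI[of _ f]) (auto intro: enn2real_leI)
qed

subsection \<open>The summation operators\<close>

text \<open>The terms of the Taylor series at \<open>z\<close> are bounded, so the absolutely
  summable row of \<open>A\<close> dominates. Thus the \<open>suminf\<close> in the definition is a
  true sum inside the disk.\<close>

lemma summation_op_sums:
  assumes A: "summable (\<lambda>k. norm (A n k))" and f: "f holomorphic_on ball 0 1" and z: "norm z < 1"
  shows "(\<lambda>k. (A n k * taylor_coeff f k) * z ^ k) sums summation_op A n f z"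
proof -
  have "(\<lambda>k. taylor_coeff f k * z ^ k) sums f z"
    using holomorphic_power_series[OF f, of z] z by (simp add: taylor_coeff_def)
  then have "Bseq (\<lambda>k. taylor_coeff f k * z ^ k)"
    by (intro convergent_imp_Bseq) (auto dest!: sums_summable summable_LIMSEQ_zero simp: convergent_def)
  then obtain M where M: "\<And>k. norm (taylor_coeff f k * z ^ k) \<le> M" by (auto simp: Bseq_def)
  have "summable (\<lambda>k. A n k * taylor_coeff f k * z ^ k)"
  proof (rule summable_comparison_test')
    show "summable (\<lambda>k. norm (A n k) * M)" using A by (rule summable_mult2)
    fix k
    show "norm (A n k * taylor_coeff f k * z ^ k) \<le> norm (A n k) * M"
      using mult_left_mono[OF M[of k], of "norm (A n k)"] by (simp add: norm_mult mult.assoc)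
  qed
  then show ?thesis unfolding summation_op_def by (rule summable_sums)
qed

lemma summation_op_holomorphic:
  assumes "summable (\<lambda>k. norm (A n k))" "f holomorphic_on ball 0 1"
  shows "summation_op A n f holomorphic_on ball 0 1"
  using power_series_holomorphic[of 0 1 "\<lambda>k. A n k * taylor_coeff f k" "summation_op A n f"]
    summation_op_sums[of A n, OF assms] by simp

lemma taylor_coeff_add:
  assumes "f holomorphic_on ball 0 1" "g holomorphic_on ball 0 1"
  shows "taylor_coeff (\<lambda>z. f z + g z) k = taylor_coeff f k + taylor_coeff g k"
  using higher_deriv_add[OF assms, of 0 k] by (simp add: taylor_coeff_def add_divide_distrib)

lemma taylor_coeff_cmult:
  assumes "f holomorphic_on ball 0 1"
  shows "taylor_coeff (\<lambda>z. c * f z) k = c * taylor_coeff f k"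
  using higher_deriv_cmult[OF assms, of 0 k c] by (simp add: taylor_coeff_def)

lemma summation_op_add:
  assumes "summable (\<lambda>k. norm (A n k))" "f holomorphic_on ball 0 1" "g holomorphic_on ball 0 1" "norm z < 1"
  shows "summation_op A n (\<lambda>z. f z + g z) z = summation_op A n f z + summation_op A n g z"
  using sums_add[OF summation_op_sums[of A n, OF assms(1,2,4)] summation_op_sums[of A n, OF assms(1,3,4)]]
    summation_op_sums[of A n, OF assms(1) holomorphic_on_add[OF assms(2,3)] assms(4)]
  by (simp add: taylor_coeff_add[OF assms(2,3)] algebra_simps sums_iff)

lemma summation_op_cmult:
  assumes "summable (\<lambda>k. norm (A n k))" "f holomorphic_on ball 0 1" "norm z < 1"
  shows "summation_op A n (\<lambda>z. c * f z) z = c * summation_op A n f z"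
  using sums_mult[OF summation_op_sums[of A n, OF assms], of c]
    summation_op_sums[of A n, OF assms(1) holomorphic_on_mult[OF holomorphic_on_const assms(2), of c] assms(3)]
  by (simp add: taylor_coeff_cmult[OF assms(2)] algebra_simps sums_iff)

lemma summation_op_dilate:
  assumes "f holomorphic_on ball 0 1" "norm u < 1"
  shows "summation_op A n (\<lambda>z. f (u * z)) z = summation_op A n f (u * z)"
  unfolding summation_op_def taylor_coeff_dilate[OF assms] by (simp add: power_mult_distrib mult_ac)

lemma norm_summation_op_le:
  assumes A: "summable (\<lambda>k. norm (A n k))" and f: "f holomorphic_on ball 0 1" and z: "norm z < 1"
    and M: "\<And>k. norm (taylor_coeff f k) \<le> M"
  shows "norm (summation_op A n f z) \<le> (\<Sum>k. norm (A n k)) * M"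
proof -
  have le: "norm (A n k * taylor_coeff f k * z ^ k) \<le> norm (A n k) * M" for k
  proof -
    have "norm (taylor_coeff f k) * norm z ^ k \<le> M * 1"
      using z M[of k] by (intro mult_mono power_le_one) (auto intro: order_trans[OF norm_ge_zero])
    then show ?thesis using mult_left_mono[of _ M "norm (A n k)"] by (simp add: norm_mult norm_power mult.assoc)
  qed
  have sm: "summable (\<lambda>k. norm (A n k) * M)" using A by (rule summable_mult2)
  have "norm (summation_op A n f z) \<le> (\<Sum>k. norm (A n k) * M)"
    unfolding summation_op_def by (intro norm_suminf_le le sm)
  then show ?thesis using A by (simp add: suminf_mult2)
qed

text \<open>Continuity of each single defect operator, with a bound depending on \<open>n\<close>:
  every Taylor coefficient is at most twice the Hardy norm, which bounds the sum uniformly on the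
  disk.\<close>

lemma summation_op_defect_bound:
  assumes p: "1 \<le> p" and A: "summable (\<lambda>k. norm (A n k))" and f: "f \<in> hardy_space p"
  shows "hardy_norm p (\<lambda>z. summation_op A n f z - f z) \<le> ennreal ((2 * (\<Sum>k. norm (A n k)) + 1) * enn2real (hardy_norm p f))"
proof -
  note fD = hardy_spaceD[OF f]
  define S where "S = (\<Sum>k. norm (A n k))"
  define N where "N = enn2real (hardy_norm p f)"
  have S: "0 \<le> S" unfolding S_def by (intro suminf_nonneg A) auto
  have N: "0 \<le> N" "hardy_norm p f = ennreal N" using fD(3) by (auto simp: N_def)
  have coeff: "norm (taylor_coeff f k) \<le> 2 * N" for k
  proof (rule field_le_epsilon)
    fix e :: real assume "0 < e"
    then show "norm (taylor_coeff f k) \<le> 2 * N + e"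
      using norm_taylor_coeff_le_hardy_norm[OF p fD(1), of "N + e/2" k] N by (simp add: ennreal_leI del: ennreal_plus)
  qed
  have hol: "summation_op A n f holomorphic_on ball 0 1" by (rule summation_op_holomorphic[of A n, OF A fD(1)])
  note cont = holomorphic_on_imp_continuous_on[OF hol]
  have "hardy_norm p (summation_op A n f) \<le> ennreal (S * (2 * N))"
    using p S N norm_summation_op_le[of A n, OF A fD(1) _ coeff]
    by (intro hardy_norm_le_bound cont) (auto simp: S_def)
  moreover have "hardy_norm p (\<lambda>z. -1 * f z) \<le> ennreal N"
    using hardy_norm_cmult_le[of p f N "-1"] p fD N by simp
  moreover have "hardy_norm p (\<lambda>z. summation_op A n f z + -1 * f z) \<le> hardy_norm p (summation_op A n f) + hardy_norm p (\<lambda>z. -1 * f z)"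
    by (intro hardy_norm_add p cont continuous_intros fD)
  ultimately have "hardy_norm p (\<lambda>z. summation_op A n f z + -1 * f z) \<le> ennreal (S * (2 * N)) + ennreal N"
    by (meson add_mono order_trans)
  also have "\<dots> = ennreal ((2 * S + 1) * N)" using S N by (simp add: algebra_simps flip: ennreal_plus)
  finally show ?thesis by (simp add: S_def N_def)
qed

subsection \<open>From circle means to area integrals\<close>

lemma nn_integral_lborel_rotate:
  fixes c :: complex
  assumes "norm c = 1" "F \<in> borel_measurable borel"
  shows "(\<integral>\<^sup>+ z. F (c * z) \<partial>lborel) = (\<integral>\<^sup>+ z. F z \<partial>lborel)"
proof -
  have "(\<integral>\<^sup>+ z. F z \<partial>distr lborel borel ((*) c)) = (\<integral>\<^sup>+ z. F (c * z) \<partial>lborel)"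
    using assms(2) by (intro nn_integral_distr) auto
  then show ?thesis by (simp add: lborel_complex_rotate[OF assms(1)])
qed

lemma borel_measurable_norm_powr_ball:
  fixes h :: "complex \<Rightarrow> complex"
  assumes "0 < p" "continuous_on (ball 0 1) h"
  shows "(\<lambda>z. ennreal (norm (h z) powr p) * indicator (ball 0 1) z) \<in> borel_measurable borel"
proof -
  have "(\<lambda>z. indicator (ball 0 1) z *\<^sub>R (norm (h z) powr p)) \<in> borel_measurable borel"
    by (intro borel_measurable_continuous_on_indicator continuous_on_norm_powr assms) auto
  then have "(\<lambda>z. ennreal (indicator (ball 0 1) z *\<^sub>R (norm (h z) powr p))) \<in> borel_measurable borel"
    by measurable
  also have "(\<lambda>z. ennreal (indicator (ball 0 1) z *\<^sub>R (norm (h z) powr p))) =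
      (\<lambda>z. ennreal (norm (h z) powr p) * indicator (ball 0 1) z)"
    by (auto simp: indicator_def)
  finally show ?thesis .
qed

text \<open>Averaging over the rotations of the disk replaces integration in polar coordinates.\<close>
lemma
  fixes h :: "complex \<Rightarrow> complex"
  assumes p: "0 < p" and h: "continuous_on (ball 0 1) h"
  shows borel_measurable_circle_mean: "(\<lambda>z. ennreal (circle_mean p (\<lambda>w. h (z * w))) * indicator (ball 0 1) z) \<in> borel_measurable borel"
    and nn_integral_ball_average: "ennreal (2 * pi) * (\<integral>\<^sup>+ z. ennreal (norm (h z) powr p) * indicator (ball 0 1) z \<partial>lborel) =
      (\<integral>\<^sup>+ z. ennreal (2 * pi) * (ennreal (circle_mean p (\<lambda>w. h (z * w))) * indicator (ball 0 1) z) \<partial>lborel)"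
proof -
  define F where "F = (\<lambda>z. ennreal (norm (h z) powr p) * indicator (ball 0 1) z)"
  have F[measurable]: "F \<in> borel_measurable borel" unfolding F_def by (rule borel_measurable_norm_powr_ball[OF p h])
  have cis[measurable]: "cis \<in> borel_measurable borel"
    by (intro borel_measurable_continuous_onI continuous_intros)
  \<comment> \<open>Rotations preserve the disk: inside it the angular integral is 2 pi times the
    circle mean of the dilate by \<open>z\<close>, and outside it both sides vanish.\<close>
  have inner: "(\<integral>\<^sup>+ \<theta>. F (cis \<theta> * z) * indicator {0..2*pi} \<theta> \<partial>lborel) =
      ennreal (2 * pi) * (ennreal (circle_mean p (\<lambda>w. h (z * w))) * indicator (ball 0 1) z)" for z
  proof (cases "norm z < 1")
    case True
    then show ?thesis
      using nn_integral_circle_mean[OF p continuous_on_sphere_dilate[OF h True]]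
      by (simp add: F_def norm_mult ennreal_mult' circle_mean_nonneg mult.commute[of z])
  next
    case False
    then show ?thesis by (simp add: F_def norm_mult)
  qed
  have meas: "(\<lambda>(z, \<theta>). F (cis \<theta> * z) * indicator {0..2*pi} \<theta>) \<in> borel_measurable (lborel \<Otimes>\<^sub>M lborel)"
    by measurable
  have "(\<lambda>z. \<integral>\<^sup>+ \<theta>. F (cis \<theta> * z) * indicator {0..2*pi} \<theta> \<partial>lborel) \<in> borel_measurable borel"
    using lborel.borel_measurable_nn_integral[OF meas] by simp
  then have "(\<lambda>z. ennreal (1 / (2 * pi)) * (\<integral>\<^sup>+ \<theta>. F (cis \<theta> * z) * indicator {0..2*pi} \<theta> \<partial>lborel)) \<in> borel_measurable borel"
    by simp
  then show "(\<lambda>z. ennreal (circle_mean p (\<lambda>w. h (z * w))) * indicator (ball 0 1) z) \<in> borel_measurable borel"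
    unfolding inner by (simp add: mult.assoc[symmetric] ennreal_mult'[symmetric])
  \<comment> \<open>The area integral is constant in \<theta>; rotating it by each angle and
    applying Tonelli moves the angular integral inside.\<close>
  have "ennreal (2 * pi) * (\<integral>\<^sup>+ z. F z \<partial>lborel) = (\<integral>\<^sup>+ \<theta>. (\<integral>\<^sup>+ z. F z \<partial>lborel) * indicator {0..2*pi} \<theta> \<partial>lborel)"
    by (subst nn_integral_cmult_indicator) (auto simp: mult.commute)
  also have "\<dots> = (\<integral>\<^sup>+ \<theta>. (\<integral>\<^sup>+ z. F (cis \<theta> * z) * indicator {0..2*pi} \<theta> \<partial>lborel) \<partial>lborel)"
    by (intro nn_integral_cong) (simp add: nn_integral_multc nn_integral_lborel_rotate)
  also have "\<dots> = (\<integral>\<^sup>+ z. (\<integral>\<^sup>+ \<theta>. F (cis \<theta> * z) * indicator {0..2*pi} \<theta> \<partial>lborel) \<partial>lborel)"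
    by (rule lborel_pair.Fubini'[OF meas])
  finally show "ennreal (2 * pi) * (\<integral>\<^sup>+ z. ennreal (norm (h z) powr p) * indicator (ball 0 1) z \<partial>lborel) =
      (\<integral>\<^sup>+ z. ennreal (2 * pi) * (ennreal (circle_mean p (\<lambda>w. h (z * w))) * indicator (ball 0 1) z) \<partial>lborel)"
    unfolding inner by (simp add: F_def)
qed

lemma nn_integral_ball_circle_mean:
  fixes h :: "complex \<Rightarrow> complex"
  assumes p: "0 < p" and h: "continuous_on (ball 0 1) h"
  shows "(\<integral>\<^sup>+ z. ennreal (norm (h z) powr p) * indicator (ball 0 1) z \<partial>lborel) =
    (\<integral>\<^sup>+ z. ennreal (circle_mean p (\<lambda>w. h (z * w))) * indicator (ball 0 1) z \<partial>lborel)"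
  using borel_measurable_circle_mean[OF assms] nn_integral_ball_average[OF assms]
  by (simp add: nn_integral_cmult ennreal_mult_cancel_left)

text \<open>Uniform boundedness for the seminorms taking f to the norm of S_n f - f. They are
  bounded for each \<open>n\<close> by the row sums, and pointwise in f because a convergent
  sequence is bounded.\<close>

lemma hardy_defect_uniformly_bounded:
  fixes A :: "nat \<Rightarrow> nat \<Rightarrow> complex"
  assumes p: "1 \<le> p" and A: "\<And>n. summable (\<lambda>k. norm (A n k))"
    and conv: "\<forall>f\<in>hardy_space p. (\<lambda>n. hardy_norm p (\<lambda>z. summation_op A n f z - f z)) \<longlonglongrightarrow> 0"
  shows "\<exists>C>0. \<forall>n. \<forall>f\<in>hardy_space p.
    hardy_norm p (\<lambda>z. summation_op A n f z - f z) \<le> ennreal (C * enn2real (hardy_norm p f))"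
proof -
  define N where "N = (\<lambda>f. enn2real (hardy_norm p f))"
  define D where "D = (\<lambda>n f z. summation_op A n f z - f z)"
  define B where "B = (\<lambda>n. 2 * (\<Sum>k. norm (A n k)) + 1)"
  have B: "0 \<le> B n" for n unfolding B_def by (intro add_nonneg_nonneg mult_nonneg_nonneg suminf_nonneg A) auto
  have D_le: "hardy_norm p (D n f) \<le> ennreal (B n * N f)" if "f \<in> hardy_space p" for n f
    unfolding D_def B_def N_def by (rule summation_op_defect_bound[of p A n, OF p A that])
  have D_in: "D n f \<in> hardy_space p" if "f \<in> hardy_space p" for n f
    by (rule hardy_spaceI[OF _ D_le[OF that]])
      (auto simp: D_def intro!: holomorphic_on_diff summation_op_holomorphic A hardy_spaceD(1)[OF that])
  have D_add: "hardy_norm p (D n (\<lambda>x. f x + g x)) = hardy_norm p (\<lambda>z. D n f z + D n g z)"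
    if "f \<in> hardy_space p" "g \<in> hardy_space p" for n f g
    by (rule hardy_norm_cong)
      (simp add: D_def summation_op_add[of A n, OF A hardy_spaceD(1)[OF that(1)] hardy_spaceD(1)[OF that(2)]])
  have D_scale: "hardy_norm p (D n (\<lambda>x. c * f x)) = hardy_norm p (\<lambda>z. c * D n f z)"
    if "f \<in> hardy_space p" for n f c
    by (rule hardy_norm_cong)
      (simp add: D_def summation_op_cmult[of A n, OF A hardy_spaceD(1)[OF that]] algebra_simps)
  have "\<exists>C>0. \<forall>n. \<forall>f\<in>hardy_space p. N (D n f) \<le> C * N f"
  proof (rule uniform_boundedness_seminorms[where B = B])
    fix f g :: "complex \<Rightarrow> complex" assume fg: "f \<in> hardy_space p" "g \<in> hardy_space p"
    show "(\<lambda>x. f x + g x) \<in> hardy_space p" "N (\<lambda>x. f x + g x) \<le> N f + N g"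
      using hardy_space_add[OF p fg] by (auto simp: N_def)
    show "N (D n (\<lambda>x. f x + g x)) \<le> N (D n f) + N (D n g)" for n
      using hardy_space_add[OF p D_in[OF fg(1)] D_in[OF fg(2)]] by (simp add: N_def D_add[OF fg])
  next
    fix c :: real and f :: "complex \<Rightarrow> complex" assume f: "f \<in> hardy_space p"
    show "(\<lambda>x. c *\<^sub>R f x) \<in> hardy_space p" "N (\<lambda>x. c *\<^sub>R f x) \<le> \<bar>c\<bar> * N f"
      using hardy_space_cmult[OF p f, of "of_real c"] by (auto simp: N_def scaleR_conv_of_real)
    show "N (D n (\<lambda>x. c *\<^sub>R f x)) \<le> \<bar>c\<bar> * N (D n f)" for n
      using hardy_space_cmult[OF p D_in[OF f], of "of_real c"] by (simp add: N_def scaleR_conv_of_real D_scale[OF f])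
  next
    fix n and f :: "complex \<Rightarrow> complex" assume f: "f \<in> hardy_space p"
    show "N (D n f) \<le> B n * N f"
      unfolding N_def by (rule enn2real_leI) (use B D_le[OF f] in \<open>auto simp: N_def\<close>)
  next
    fix f :: "complex \<Rightarrow> complex" assume f: "f \<in> hardy_space p"
    have "(\<lambda>n. hardy_norm p (D n f)) \<longlonglongrightarrow> 0" using conv f by (auto simp: D_def)
    then have "(\<lambda>n. N (D n f)) \<longlonglongrightarrow> 0"
      unfolding N_def using tendsto_enn2real[of "\<lambda>n. hardy_norm p (D n f)" 0] by simp
    then have "Bseq (\<lambda>n. N (D n f))" by (intro convergent_imp_Bseq) (auto simp: convergent_def)
    then obtain K where "\<And>n. norm (N (D n f)) \<le> K" by (auto simp: Bseq_def)
    then show "\<exists>K. \<forall>n. N (D n f) \<le> K" by (intro exI[of _ K]) (auto intro: order_trans[OF abs_ge_self])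
  next
    fix X and e :: "nat \<Rightarrow> real"
    assume "\<And>k. X k \<in> hardy_space p" "\<And>m n. m \<le> n \<Longrightarrow> N (\<lambda>x. X n x - X m x) \<le> e m" "e \<longlonglongrightarrow> 0"
    then show "\<exists>f\<in>hardy_space p. \<forall>m. N (\<lambda>x. f x - X m x) \<le> e m"
      unfolding N_def by (intro hardy_space_complete p)
  qed (simp add: N_def)
  then obtain C where C: "0 < C" "\<And>n f. f \<in> hardy_space p \<Longrightarrow> N (D n f) \<le> C * N f" by blast
  show ?thesis
  proof (intro exI[of _ C] conjI allI ballI)
    fix n f assume f: "f \<in> hardy_space p"
    have "hardy_norm p (D n f) = ennreal (N (D n f))" unfolding N_def by (rule hardy_spaceD(3)[OF D_in[OF f]])
    also have "\<dots> \<le> ennreal (C * N f)" by (intro ennreal_leI C f)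
    finally show "hardy_norm p (\<lambda>z. summation_op A n f z - f z) \<le> ennreal (C * enn2real (hardy_norm p f))"
      by (simp add: D_def N_def)
  qed (rule C)
qed

section \<open>Transfer from the Hardy space to the Bergman space\<close>

theorem theorem5p5:
  fixes p :: real and A :: "nat \<Rightarrow> nat \<Rightarrow> complex"
  assumes "1 \<le> p"
    and "\<And>n. summable (\<lambda>k. norm (A n k))"
    and "\<forall>f \<in> hardy_space p.
           ((\<lambda>n. hardy_norm p (\<lambda>z. summation_op A n f z - f z)) \<longlongrightarrow> 0) sequentially"
  shows "\<forall>g \<in> bergman_space p.
           ((\<lambda>n. bergman_norm p (\<lambda>z. summation_op A n g z - g z)) \<longlongrightarrow> 0) sequentially"
proof
  fix g assume "g \<in> bergman_space p"
  then have g: "g holomorphic_on ball 0 1" and g_fin: "bergman_norm p g < \<infinity>"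
    by (auto simp: bergman_space_def)
  have p: "1 \<le> p" "0 < p" using assms(1) by auto
  obtain C where C: "0 < C" and bound: "\<And>n f. f \<in> hardy_space p \<Longrightarrow>
      hardy_norm p (\<lambda>z. summation_op A n f z - f z) \<le> ennreal (C * enn2real (hardy_norm p f))"
    using hardy_defect_uniformly_bounded[OF assms] by blast
  define h where "h = (\<lambda>n z. summation_op A n g z - g z)"
  have cont: "continuous_on (ball 0 1) (h n)" for n
    unfolding h_def
    by (intro holomorphic_on_imp_continuous_on holomorphic_on_diff summation_op_holomorphic assms g)
  have contg: "continuous_on (ball 0 1) g" using g by (rule holomorphic_on_imp_continuous_on)
  \<comment> \<open>For holomorphic \<open>f\<close> this is the p-th power of the Hardy norm of the
    dilate by \<open>z\<close>, extended by 0. The form as a circle mean makes it measurable in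
    \<open>z\<close>.\<close>
  define u where "u = (\<lambda>f z. ennreal (circle_mean p (\<lambda>w. f (z * w))) * indicator (ball 0 1) z)"
  have u_meas: "u f \<in> borel_measurable borel" if "continuous_on (ball 0 1) f" for f
    unfolding u_def by (rule borel_measurable_circle_mean[OF p(2) that])
  have u_int: "(\<integral>\<^sup>+ z. ennreal (norm (f z) powr p) * indicator (ball 0 1) z \<partial>lborel) = (\<integral>\<^sup>+ z. u f z \<partial>lborel)"
    if "continuous_on (ball 0 1) f" for f
    unfolding u_def by (rule nn_integral_ball_circle_mean[OF p(2) that])
  have defect: "hardy_norm p (\<lambda>w. summation_op A n (\<lambda>w. g (z * w)) w - g (z * w)) = hardy_norm p (\<lambda>w. h n (z * w))"
    if "norm z < 1" for n z
    by (rule hardy_norm_cong) (simp add: h_def summation_op_dilate[OF g that])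
  have dil: "(\<lambda>w. g (z * w)) \<in> hardy_space p" if z: "norm z < 1" for z
  proof -
    obtain R where "1 < R" "(\<lambda>w. g (z * w)) holomorphic_on ball 0 R" using holomorphic_on_dilate[OF g z] by blast
    then have "(\<lambda>w. g (z * w)) holomorphic_on ball 0 1" by (elim holomorphic_on_subset) auto
    then show ?thesis using hardy_norm_dilate_le[OF p(1) g z] by (rule hardy_spaceI)
  qed
  \<comment> \<open>The uniform constant \<open>C\<close> bounds the error of the dilate of
    \<open>g\<close> by \<open>C\<close> times the Hardy norm of that dilate, whose p-th power is at
    most the circle mean in \<open>u g z\<close>.\<close>
  have dom: "u (h n) z \<le> ennreal (C powr p) * u g z" for n z
  proof (cases "norm z < 1")
    case True
    define N where "N = enn2real (hardy_norm p (\<lambda>w. g (z * w)))"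
    have "N \<le> circle_mean p (\<lambda>w. g (z * w)) powr (1 / p)"
      unfolding N_def by (rule enn2real_leI[OF _ hardy_norm_dilate_le[OF p(1) g True]]) simp
    moreover have "circle_mean p (\<lambda>w. h n (z * w)) \<le> (C * N) powr p"
      using bound[OF dil[OF True]] C p
      by (intro circle_mean_dilate_le_hardy_norm cont True) (auto simp: defect[OF True] N_def)
    moreover have "0 \<le> N" by (simp add: N_def)
    ultimately have "circle_mean p (\<lambda>w. h n (z * w)) \<le> (C * circle_mean p (\<lambda>w. g (z * w)) powr (1 / p)) powr p"
      using C p by (elim order_trans) (auto intro!: powr_mono2)
    also have "\<dots> = C powr p * circle_mean p (\<lambda>w. g (z * w))"
      using C p by (simp add: powr_mult powr_powr circle_mean_nonneg)
    finally show ?thesis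
      using True by (simp add: u_def ennreal_leI flip: ennreal_mult')
  qed (simp add: u_def)
  have lim: "(\<lambda>n. u (h n) z) \<longlonglongrightarrow> 0" for z
  proof (cases "norm z < 1")
    case True
    have "(\<lambda>n. hardy_norm p (\<lambda>w. h n (z * w))) \<longlonglongrightarrow> 0"
      using bspec[OF assms(3) dil[OF True]] unfolding defect[OF True] .
    then have lim: "(\<lambda>n. enn2real (hardy_norm p (\<lambda>w. h n (z * w)))) \<longlonglongrightarrow> 0"
      using tendsto_enn2real[of "\<lambda>n. hardy_norm p (\<lambda>w. h n (z * w))" 0] by simp
    have "circle_mean p (\<lambda>w. h n (z * w)) \<le> enn2real (hardy_norm p (\<lambda>w. h n (z * w))) powr p" for n
    proof (rule circle_mean_dilate_le_hardy_norm[OF p(2) _ cont True])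
      have "hardy_norm p (\<lambda>w. h n (z * w)) < top"
        \<comment> \<open>Finiteness ensures that \<open>enn2real\<close> loses nothing.\<close>
        using bound[OF dil[OF True], of n] by (auto simp: defect[OF True] intro: le_less_trans)
      then show "hardy_norm p (\<lambda>w. h n (z * w)) \<le> ennreal (enn2real (hardy_norm p (\<lambda>w. h n (z * w))))" by simp
    qed simp
    moreover have "(\<lambda>n. enn2real (hardy_norm p (\<lambda>w. h n (z * w))) powr p) \<longlonglongrightarrow> 0"
      using p tendsto_powr2[OF lim tendsto_const[of p]] by simp
    ultimately have "(\<lambda>n. circle_mean p (\<lambda>w. h n (z * w))) \<longlonglongrightarrow> 0"
      using tendsto_sandwich[of "\<lambda>_. 0" "\<lambda>n. circle_mean p (\<lambda>w. h n (z * w))" sequentially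
        "\<lambda>n. enn2real (hardy_norm p (\<lambda>w. h n (z * w))) powr p" 0]
      by (simp add: circle_mean_nonneg)
    from tendsto_ennrealI[OF this] show ?thesis using True by (simp add: u_def)
  qed (simp add: u_def)
  have "(\<integral>\<^sup>+ z. u g z \<partial>lborel) < \<infinity>"
  proof -
    \<comment> \<open>\<open>enn_root\<close> sends infinity to infinity, so a finite Bergman norm
      forces a finite integral.\<close>
    have "ennreal (1 / pi) * (\<integral>\<^sup>+ z. u g z \<partial>lborel) \<noteq> \<infinity>"
      using g_fin unfolding bergman_norm_def u_int[OF contg] by (auto simp: enn_root_def split: if_splits)
    then show ?thesis by (auto simp: ennreal_mult_eq_top_iff less_top)
  qed
  then have fin: "(\<integral>\<^sup>+ z. ennreal (C powr p) * u g z \<partial>lborel) < \<infinity>"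
    using u_meas[OF contg] by (simp add: nn_integral_cmult ennreal_mult_less_top)
  \<comment> \<open>Dominated convergence over the disk, with the integrable majorant
    \<open>ennreal (C powr p) * u g z\<close>.\<close>
  have "(\<lambda>n. \<integral>\<^sup>+ z. u (h n) z \<partial>lborel) \<longlonglongrightarrow> (\<integral>\<^sup>+ z. 0 \<partial>(lborel :: complex measure))"
    using u_meas[OF cont] u_meas[OF contg] dom lim fin
    by (intro nn_integral_dominated_convergence[where w = "\<lambda>z. ennreal (C powr p) * u g z"]) auto
  then have "(\<lambda>n. ennreal (1 / pi) * (\<integral>\<^sup>+ z. u (h n) z \<partial>lborel)) \<longlonglongrightarrow> ennreal (1 / pi) * 0"
    by (intro ennreal_tendsto_cmult) auto
  then show "(\<lambda>n. bergman_norm p (\<lambda>z. summation_op A n g z - g z)) \<longlonglongrightarrow> 0"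
    unfolding bergman_norm_def enn_root_tendsto_0_iff[OF p(2)]
    using u_int[OF cont] by (simp add: h_def)
qed

end
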